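(* Let $\psi\in L^2(\mathbb{R}^2)$ and for $u\in\mathbb{R}$, $s>0$ put $$\psi_{u,s}(x_1,x_2)=s^{-1/2}\psi\left(\frac{x_1-u}{s},x_2\right).$$ The system $\{\psi_{u,s}\}_{u\in\mathbb{R},s>0}$, with parameter measure $\frac{du\,ds}{s^2}$ on $\mathbb{R}\times(0,\infty)$, is reproducing in $L^2(\mathbb{R}^2)$ if and only if each of the two maps (one for the sign $+$, one for the sign $-$) $$f\mapsto \int_{\mathbb{R}} \overline{\psi\left(\widehat{\pm s},y\right)}\, f(y)\,dy ,$$ from $L^2(\mathbb{R})$ into $L^2\left(\mathbb{R}_+,\frac{ds}{s}\right)$, preserves inner products.
   Context: The Fourier transform is $\hat f(\xi)=\int f(x)e^{-2\pi i x\xi}\,dx$ (extended to $L^2$ by Plancherel). For a function $\psi(x_1,x_2)$, the notation $\psi(\hat{s},y)$ denotes the Fourier transform of $\psi$ in the first variable only, evaluated at frequency $s$, with the second variable equal to $y$; thus $\psi(\widehat{\pm s},y)$ is this partial Fourier transform evaluated at $\pm s$, $s>0$. A system $\{\psi_{u,s}\}$ with parameter measure $\frac{du\,ds}{s^2}$ is called reproducing in $L^2(\mathbb{R}^2)$ if $f=\int_{\mathbb{R}\times(0,\infty)}\langle f,\psi_{u,s}\rangle\psi_{u,s}\,\frac{du\,ds}{s^2}$ for all $f\in L^2(\mathbb{R}^2)$ with the integral converging weakly, i.e. $\int_{\mathbb{R}\times(0,\infty)}\langle f,\psi_{u,s}\rangle\langle\psi_{u,s},g\rangle\frac{du\,ds}{s^2}=\langle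 f,g\rangle$ for all $f,g\in L^2(\mathbb{R}^2)$. *)

theory Defs
  imports "HOL-Analysis.Analysis"
begin

definition L2 :: "'a measure \<Rightarrow> ('a \<Rightarrow> complex) \<Rightarrow> bool" where
  "L2 M f \<longleftrightarrow> f \<in> borel_measurable M \<and> integrable M (\<lambda>x. (cmod (f x))\<^sup>2)"

definition L2_inner :: "'a measure \<Rightarrow> ('a \<Rightarrow> complex) \<Rightarrow> ('a \<Rightarrow> complex) \<Rightarrow> complex" where
  "L2_inner M f g = (LINT x|M. f x * cnj (g x))"

text \<open>Reproducing system: for all f, g in L2(R^2) the function
  p \<mapsto> <f,psi_p><psi_p,g> is integrable for the parameter measure P and
  its integral is <f,g> (weak convergence of the reproducing formula).\<close>
definition reproducing ::
  "'p measure \<Rightarrow> ('p \<Rightarrow> real \<times> real \<Rightarrow> complex) \<Rightarrow> bool" where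
  "reproducing P sys \<longleftrightarrow>
    (\<forall>f g. L2 (lborel :: (real \<times> real) measure) f \<longrightarrow> L2 lborel g \<longrightarrow>
       integrable P (\<lambda>p. L2_inner lborel f (sys p) * L2_inner lborel (sys p) g) \<and>
       (LINT p|P. L2_inner lborel f (sys p) * L2_inner lborel (sys p) g) = L2_inner lborel f g)"

definition param_measure :: "(real \<times> real) measure" where
  "param_measure = density lborel (\<lambda>(u,s). ennreal (if s > 0 then 1 / s\<^sup>2 else 0))"

definition half_line_ds_s :: "real measure" where
  "half_line_ds_s = density lborel (\<lambda>s. ennreal (if s > 0 then 1 / s else 0))"

definition psi_us :: "(real \<times> real \<Rightarrow> complex) \<Rightarrow> real \<times> real \<Rightarrow> real \<times> real \<Rightarrow> complex" where
  "psi_us \<psi> = (\<lambda>(u,s) (x1,x2). complex_of_real (s powr (-1/2)) * \<psi> ((x1 - u) / s, x2))"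

definition trunc_partial_FT :: "nat \<Rightarrow> (real \<times> real \<Rightarrow> complex) \<Rightarrow> real \<times> real \<Rightarrow> complex" where
  "trunc_partial_FT n \<psi> = (\<lambda>(\<xi>,y). LINT x:{-real n..real n}|lborel. \<psi> (x,y) * cis (-2 * pi * x * \<xi>))"

text \<open>Psi is (a representative of) the partial Fourier transform of psi in the first
  variable, defined by Plancherel: the L2(R^2)-limit of the truncated transforms.\<close>
definition is_partial_FT :: "(real \<times> real \<Rightarrow> complex) \<Rightarrow> (real \<times> real \<Rightarrow> complex) \<Rightarrow> bool" where
  "is_partial_FT \<psi> \<Psi> \<longleftrightarrow> L2 lborel \<Psi> \<and>
     (\<forall>n. L2 lborel (\<lambda>z. \<Psi> z - trunc_partial_FT n \<psi> z)) \<and>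
     (\<lambda>n. LINT z|lborel. (cmod (\<Psi> z - trunc_partial_FT n \<psi> z))\<^sup>2) \<longlonglongrightarrow> 0"

definition preserves_inner ::
  "'a measure \<Rightarrow> 'b measure \<Rightarrow> (('a \<Rightarrow> complex) \<Rightarrow> ('b \<Rightarrow> complex)) \<Rightarrow> bool" where
  "preserves_inner M N T \<longleftrightarrow>
    (\<forall>f g. L2 M f \<longrightarrow> L2 M g \<longrightarrow>
       L2 N (T f) \<and> L2 N (T g) \<and> L2_inner N (T f) (T g) = L2_inner M f g)"

end

theory Submission
  imports Defs "HOL-Probability.Characteristic_Functions"
begin

text \<open>For fixed \<open>s\<close> the map \<open>u \<mapsto> \<langle>f, \<psi>\<^bsub>u,s\<^esub>\<rangle>\<close> is \<open>\<surd>s\<close> times the inverse Fourier transform of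
  \<open>H\<^sub>s(\<xi>) = \<integral> F(\<xi>,y) cnj (\<Psi>(s\<xi>,y)) dy\<close>, where \<open>F\<close> is the partial Fourier transform of \<open>f\<close>.
  Plancherel in \<open>u\<close>, Tonelli, and the scale invariance of \<open>ds/s\<close> then give
  \<open>\<integral> |\<langle>f, \<psi>\<^bsub>u,s\<^esub>\<rangle>|\<^sup>2 du ds/s\<^sup>2 = \<integral> \<parallel>T\<^bsub>sgn \<xi>\<^esub> F(\<xi>,\<cdot>)\<parallel>\<^sup>2 d\<xi>\<close>, where \<open>T\<^sub>+\<close> and \<open>T\<^sub>-\<close> are the two
  slice maps. If both are isometric, the right side is \<open>\<parallel>F\<parallel>\<^sup>2 = \<parallel>f\<parallel>\<^sup>2\<close>. Conversely, test functions
  whose frequency content is pushed towards \<open>\<plusminus>\<infinity>\<close> isolate the two signs. Polarization passes between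
  norms and inner products. All norms are kept as extended nonnegative integrals, so Plancherel is needed,
  and proved, for \<open>H\<^sub>s\<close> merely integrable: \<open>\<parallel>H\<^sub>s\<parallel>\<close> may a priori be infinite.\<close>

section \<open>Square norms and polarization\<close>

text \<open>The given \<open>\<Psi>\<close> is only an L2-limit of truncated transforms, and its
  slices are square integrable only for almost every frequency. The frequency-side computation is
  therefore made for functions of bounded support in the first variable, whose partial transform is
  an actual integral; Parseval against \<open>\<psi>\<close> comes from truncating
  \<open>\<psi>\<close> as well. \<open>H\<^sub>s\<close> is integrable because it integrates over
  \<open>y\<close> a product of two L2 functions of the plane. Its Plancherel identity is reached by
  Gaussian regularization, where inversion is explicit, with Fatou used once in each direction. On
  return to all of L2, Fatou applied to truncations bounds the norm only from above; the lower bound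
  comes from reflecting \<open>f\<close> through its truncation. The two signs can be separated
  because, for a fixed \<open>h\<close> in the second variable, scale invariance makes the slice
  norm depend on the frequency through its sign alone. Modulation then only slides a weight of total
  mass 1 across the point 0.\<close>

definition sqnorm :: "'a measure \<Rightarrow> ('a \<Rightarrow> complex) \<Rightarrow> ennreal" where
  "sqnorm M f = (\<integral>\<^sup>+x. ennreal ((cmod (f x))\<^sup>2) \<partial>M)"

lemma borel_measurable_cnj [measurable]: "cnj \<in> borel_measurable borel"
  by (intro borel_measurable_continuous_onI continuous_intros)

lemma L2_measurable [measurable_dest]: "L2 M f \<Longrightarrow> f \<in> borel_measurable M"
  by (simp add: L2_def)

lemma L2_iff_sqnorm: "L2 M f \<longleftrightarrow> f \<in> borel_measurable M \<and> sqnorm M f < \<infinity>"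
  unfolding L2_def sqnorm_def by (auto simp: integrable_iff_bounded)

lemma sqnorm_eq_integral:
  "L2 M f \<Longrightarrow> sqnorm M f = ennreal (LINT x|M. (cmod (f x))\<^sup>2)"
  unfolding sqnorm_def L2_def by (subst nn_integral_eq_integral) auto

lemma sqnorm_cong_AE: "AE x in M. f x = g x \<Longrightarrow> sqnorm M f = sqnorm M g"
  unfolding sqnorm_def by (intro nn_integral_cong_AE) auto

text \<open>A crude bound in place of Minkowski: only finiteness matters, since it serves the
  closure of \<open>L2\<close> under sums.\<close>

lemma sqnorm_add_le:
  assumes [measurable]: "f \<in> borel_measurable M" "g \<in> borel_measurable M"
  shows "sqnorm M (\<lambda>x. f x + g x) \<le> 2 * sqnorm M f + 2 * sqnorm M g"
proof -
  have "(cmod (a + b))\<^sup>2 \<le> 2 * (cmod a)\<^sup>2 + 2 * (cmod b)\<^sup>2" for a b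
  proof -
    have "(cmod (a + b))\<^sup>2 \<le> (cmod a + cmod b)\<^sup>2"
      by (intro power_mono norm_triangle_ineq) auto
    also have "\<dots> \<le> 2 * (cmod a)\<^sup>2 + 2 * (cmod b)\<^sup>2"
      using zero_le_power2[of "cmod a - cmod b"] by (simp add: power2_eq_square algebra_simps)
    finally show ?thesis .
  qed
  then have "sqnorm M (\<lambda>x. f x + g x)
      \<le> (\<integral>\<^sup>+x. ennreal (2 * (cmod (f x))\<^sup>2 + 2 * (cmod (g x))\<^sup>2) \<partial>M)"
    unfolding sqnorm_def by (intro nn_integral_mono ennreal_leI)
  also have "\<dots> = 2 * sqnorm M f + 2 * sqnorm M g"
    unfolding sqnorm_def by (simp add: ennreal_plus ennreal_mult nn_integral_add nn_integral_cmult)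
  finally show ?thesis .
qed

lemma sqnorm_scale:
  assumes [measurable]: "f \<in> borel_measurable M"
  shows "sqnorm M (\<lambda>x. c * f x) = ennreal ((cmod c)\<^sup>2) * sqnorm M f"
  unfolding sqnorm_def by (simp add: norm_mult power_mult_distrib ennreal_mult nn_integral_cmult)

lemma L2_add: "L2 M f \<Longrightarrow> L2 M g \<Longrightarrow> L2 M (\<lambda>x. f x + g x)"
  using sqnorm_add_le[of f M g]
  by (auto simp: L2_iff_sqnorm ennreal_mult_less_top le_less_trans)

lemma L2_scale: "L2 M f \<Longrightarrow> L2 M (\<lambda>x. c * f x)"
  by (auto simp: L2_iff_sqnorm sqnorm_scale ennreal_mult_less_top)

lemma L2_bound:
  assumes "L2 M f" and [measurable]: "g \<in> borel_measurable M" and "\<And>x. cmod (g x) \<le> cmod (f x)"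
  shows "L2 M g"
proof -
  have "sqnorm M g \<le> sqnorm M f"
    unfolding sqnorm_def using assms by (intro nn_integral_mono ennreal_leI power_mono) auto
  then show ?thesis using assms by (auto simp: L2_iff_sqnorm)
qed

lemma L2_integrable_mult:
  assumes "L2 M f" "L2 M g" shows "integrable M (\<lambda>x. f x * cnj (g x))"
proof (rule Bochner_Integration.integrable_bound)
  show "integrable M (\<lambda>x. (cmod (f x))\<^sup>2 + (cmod (g x))\<^sup>2)"
    using assms by (auto simp: L2_def)
  show "(\<lambda>x. f x * cnj (g x)) \<in> borel_measurable M"
    using assms[THEN L2_measurable] by measurable
  have "cmod a * cmod b \<le> (cmod a)\<^sup>2 + (cmod b)\<^sup>2" for a b
    using sum_squares_bound[of "cmod a" "cmod b"] mult_nonneg_nonneg[OF norm_ge_zero[of a] norm_ge_zero[of b]]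
    by linarith
  then show "AE x in M. norm (f x * cnj (g x)) \<le> norm ((cmod (f x))\<^sup>2 + (cmod (g x))\<^sup>2)"
    by (simp add: norm_mult)
qed

lemma L2_inner_commute: "L2_inner M f g = cnj (L2_inner M g f)"
proof -
  have "cnj (L2_inner M g f) = (LINT x|M. cnj (g x * cnj (f x)))"
    unfolding L2_inner_def by (rule Bochner_Integration.integral_cnj[symmetric])
  then show ?thesis by (simp add: L2_inner_def mult.commute)
qed

lemma L2_inner_add_scale:
  assumes "L2 M f" "L2 M g" "L2 M k"
  shows "L2_inner M (\<lambda>x. f x + c * g x) k = L2_inner M f k + c * L2_inner M g k"
  unfolding L2_inner_def
  using L2_integrable_mult[OF assms(1,3)] L2_integrable_mult[OF assms(2,3)]
  by (simp add: distrib_right mult.assoc)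

lemma L2_inner_cauchy_schwarz:
  assumes "L2 M f" "L2 M g"
  shows "ennreal ((cmod (L2_inner M f g))\<^sup>2) \<le> sqnorm M f * sqnorm M g"
proof -
  note [measurable] = assms[THEN L2_measurable]
  have "ennreal (cmod (L2_inner M f g)) \<le> (\<integral>\<^sup>+x. ennreal (cmod (f x)) * ennreal (cmod (g x)) \<partial>M)"
    unfolding L2_inner_def
    using integral_norm_bound_ennreal[OF L2_integrable_mult[OF assms]]
    by (simp add: norm_mult ennreal_mult)
  then have "(ennreal (cmod (L2_inner M f g)))\<^sup>2
      \<le> (\<integral>\<^sup>+x. ennreal (cmod (f x)) * ennreal (cmod (g x)) \<partial>M)\<^sup>2"
    by (intro power_mono) auto
  also have "\<dots> \<le> sqnorm M f * sqnorm M g"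
    unfolding sqnorm_def
    using Cauchy_Schwarz_nn_integral[of "\<lambda>x. ennreal (cmod (f x))" M "\<lambda>x. ennreal (cmod (g x))"]
    by (simp add: ennreal_power)
  finally show ?thesis by (simp add: ennreal_power)
qed

lemma integral_sq_add_scale:
  assumes "L2 M f" "L2 M g"
  shows "(LINT x|M. (cmod (f x + c * g x))\<^sup>2) =
    (LINT x|M. (cmod (f x))\<^sup>2) + (cmod c)\<^sup>2 * (LINT x|M. (cmod (g x))\<^sup>2)
      + 2 * Re (cnj c * L2_inner M f g)"
proof -
  have eq: "(cmod (a + c * b))\<^sup>2 = (cmod a)\<^sup>2 + (cmod c)\<^sup>2 * (cmod b)\<^sup>2 + 2 * Re (cnj c * (a * cnj b))" for a b
    unfolding cmod_power2 by (simp add: power2_eq_square algebra_simps)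
  have i: "integrable M (\<lambda>x. cnj c * (f x * cnj (g x)))"
    using L2_integrable_mult[OF assms] by simp
  have "(LINT x|M. Re (cnj c * (f x * cnj (g x)))) = Re (cnj c * L2_inner M f g)"
    using i unfolding L2_inner_def by (subst integral_Re) simp_all
  then show ?thesis
    unfolding eq using assms integrable_Re[OF i]
    by (simp only: L2_def Bochner_Integration.integral_add Bochner_Integration.integrable_add
        Bochner_Integration.integral_mult_right_zero Bochner_Integration.integrable_mult_right simp_thms)
qed

text \<open>Expanding the square shows that the norms fix \<open>Re (cnj c * L2_inner N F G)\<close>
  for every \<open>c\<close>; \<open>c = 1\<close> gives the real part of the inner product and
  \<open>c = \<i>\<close> the imaginary part, while \<open>c = 0\<close> gives the norm of
  \<open>F\<close>. It is phrased for two pairs of functions rather than for a linear map, so that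
  it also serves transforms that are additive only on almost every slice.\<close>

lemma polarization:
  assumes "L2 M f" "L2 M g" and [measurable]: "F \<in> borel_measurable N" "G \<in> borel_measurable N"
    and G: "sqnorm N G = sqnorm M g"
    and FG: "\<And>c. sqnorm N (\<lambda>x. F x + c * G x) = sqnorm M (\<lambda>x. f x + c * g x)"
  shows "L2 N F" "L2 N G" "L2_inner N F G = L2_inner M f g"
proof -
  have F: "sqnorm N F = sqnorm M f" using FG[of 0] by simp
  show L: "L2 N F" "L2 N G" using assms(1,2) F G by (auto simp: L2_iff_sqnorm)
  have real: "(LINT x|N. (cmod (u x))\<^sup>2) = (LINT x|M. (cmod (v x))\<^sup>2)"
    if "L2 N u" "L2 M v" "sqnorm N u = sqnorm M v" for u v
    using that by (simp add: sqnorm_eq_integral)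
  have "Re (cnj c * L2_inner N F G) = Re (cnj c * L2_inner M f g)" for c
    using integral_sq_add_scale[OF L, of c] integral_sq_add_scale[OF assms(1,2), of c]
      real[OF L(1) assms(1) F] real[OF L(2) assms(2) G]
      real[OF L2_add[OF L(1) L2_scale[OF L(2)]] L2_add[OF assms(1) L2_scale[OF assms(2)]] FG, of c]
    by simp
  from this[of 1] this[of "\<i>"] show "L2_inner N F G = L2_inner M f g"
    by (simp add: complex_eq_iff)
qed

text \<open>Linearity is asked only almost everywhere: a Bochner integral takes the value 0 where
  its integrand is not integrable, so the integral maps considered below are shown to be additive
  only off a null set of parameters.\<close>

lemma preserves_inner_iff_sqnorm:
  assumes meas: "\<And>f. L2 M f \<Longrightarrow> T f \<in> borel_measurable N"
    and lin: "\<And>f g c. L2 M f \<Longrightarrow> L2 M g \<Longrightarrow>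
      AE x in N. T (\<lambda>x. f x + c * g x) x = T f x + c * T g x"
  shows "preserves_inner M N T \<longleftrightarrow> (\<forall>f. L2 M f \<longrightarrow> sqnorm N (T f) = sqnorm M f)"
proof
  assume *: "preserves_inner M N T"
  have sq: "L2_inner K u u = complex_of_real (LINT x|K. (cmod (u x))\<^sup>2)" for K :: "'c measure" and u
    unfolding L2_inner_def complex_norm_square[symmetric] by (rule integral_complex_of_real)
  show "\<forall>f. L2 M f \<longrightarrow> sqnorm N (T f) = sqnorm M f"
  proof safe
    fix f assume f: "L2 M f"
    then have "L2 N (T f)" "L2_inner N (T f) (T f) = L2_inner M f f"
      using * by (auto simp: preserves_inner_def)
    then show "sqnorm N (T f) = sqnorm M f"
      using f by (simp add: sqnorm_eq_integral sq)
  qed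
next
  assume *: "\<forall>f. L2 M f \<longrightarrow> sqnorm N (T f) = sqnorm M f"
  show "preserves_inner M N T" unfolding preserves_inner_def
  proof (intro allI impI)
    fix f g assume fg: "L2 M f" "L2 M g"
    have "sqnorm N (\<lambda>x. T f x + c * T g x) = sqnorm M (\<lambda>x. f x + c * g x)" for c
      using sqnorm_cong_AE[OF lin[OF fg, of c]] * L2_add[OF fg(1) L2_scale[OF fg(2), of c]]
      by simp
    from polarization[OF fg meas meas _ this] * fg
    show "L2 N (T f) \<and> L2 N (T g) \<and> L2_inner N (T f) (T g) = L2_inner M f g"
      by simp
  qed
qed

text \<open>On the diagonal \<open>g = f\<close> the integrand is the squared modulus of the
  coefficient, so its integrability is exactly membership in \<open>L2 P\<close>. Conversely, a
  product of two \<open>L2 P\<close> functions is integrable.\<close>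

lemma reproducing_iff_preserves_inner:
  assumes meas: "\<And>f. L2 lborel f \<Longrightarrow> (\<lambda>p. L2_inner lborel f (sys p)) \<in> borel_measurable P"
  shows "reproducing P sys \<longleftrightarrow> preserves_inner lborel P (\<lambda>f p. L2_inner lborel f (sys p))"
proof
  have c: "L2_inner lborel (sys p) g = cnj (L2_inner lborel g (sys p))" for p g
    by (rule L2_inner_commute)
  assume *: "reproducing P sys"
  have "L2 P (\<lambda>p. L2_inner lborel f (sys p))" if "L2 lborel f" for f
  proof -
    have "integrable P (\<lambda>p. complex_of_real ((cmod (L2_inner lborel f (sys p)))\<^sup>2))"
      unfolding complex_norm_square
      using * that unfolding reproducing_def c by blast
    then show ?thesis unfolding L2_def using meas[OF that]
      by (simp only: complex_of_real_integrable_eq simp_thms)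
  qed
  then show "preserves_inner lborel P (\<lambda>f p. L2_inner lborel f (sys p))"
    using * unfolding preserves_inner_def reproducing_def c by (simp add: L2_inner_def[of P])
next
  have c: "L2_inner lborel (sys p) g = cnj (L2_inner lborel g (sys p))" for p g
    by (rule L2_inner_commute)
  assume *: "preserves_inner lborel P (\<lambda>f p. L2_inner lborel f (sys p))"
  show "reproducing P sys"
    unfolding reproducing_def c
    using * L2_integrable_mult[of P] unfolding preserves_inner_def by (simp add: L2_inner_def[of P])
qed

section \<open>Plancherel's theorem for integrable functions\<close>

definition fourier :: "(real \<Rightarrow> complex) \<Rightarrow> real \<Rightarrow> complex" where
  "fourier f \<xi> = (LINT x|lborel. f x * cis (-2 * pi * x * \<xi>))"

lemma borel_measurable_cis [measurable]: "cis \<in> borel_measurable borel"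
  by (intro borel_measurable_continuous_onI) (auto simp: cis_conv_exp intro!: continuous_intros)

lemma integrable_mult_bounded:
  fixes f k :: "'a \<Rightarrow> complex"
  assumes "integrable M f" and [measurable]: "k \<in> borel_measurable M" and "\<And>x. cmod (k x) \<le> B"
  shows "integrable M (\<lambda>x. f x * k x)"
proof (rule Bochner_Integration.integrable_bound)
  show "integrable M (\<lambda>x. B * cmod (f x))" using assms by simp
  have "cmod (f x) * cmod (k x) \<le> \<bar>B\<bar> * cmod (f x)" for x
    using assms(3)[of x] by (subst mult.commute) (intro mult_right_mono, auto)
  then show "AE x in M. norm (f x * k x) \<le> norm (B * cmod (f x))"
    by (simp add: norm_mult abs_mult)
qed (use assms in measurable)

lemma fourier_integrable:
  "integrable lborel f \<Longrightarrow> integrable lborel (\<lambda>x. f x * cis (-2 * pi * x * \<xi>))"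
  by (rule integrable_mult_bounded[where B=1]) auto

lemma borel_measurable_fourier [measurable]:
  assumes [measurable]: "f \<in> borel_measurable borel"
  shows "fourier f \<in> borel_measurable borel"
  unfolding fourier_def[abs_def] by measurable

lemma cmod_fourier_le:
  "integrable lborel f \<Longrightarrow> cmod (fourier f \<xi>) \<le> (LINT x|lborel. cmod (f x))"
  unfolding fourier_def using integral_norm_bound[of lborel "\<lambda>x. f x * cis (-2 * pi * x * \<xi>)"]
  by (simp add: norm_mult)

lemma integrable_pair_mult:
  fixes f g :: "real \<Rightarrow> complex"
  assumes "integrable lborel f" "integrable lborel g"
  shows "integrable (lborel \<Otimes>\<^sub>M lborel) (\<lambda>(x, y). f x * g y)"
proof (rule lborel_pair.Fubini_integrable)
  have [measurable]: "f \<in> borel_measurable borel" "g \<in> borel_measurable borel"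
    using assms by auto
  show "(\<lambda>(x, y). f x * g y) \<in> borel_measurable (lborel \<Otimes>\<^sub>M lborel)" by measurable
qed (use assms in \<open>auto simp: norm_mult\<close>)

lemma Fubini_bounded_kernel:
  fixes f g :: "real \<Rightarrow> complex"
  assumes "integrable lborel f" "integrable lborel g"
    and [measurable]: "case_prod k \<in> borel_measurable (borel \<Otimes>\<^sub>M borel)"
    and "\<And>x y. cmod (k x y) \<le> 1"
  shows "(LINT y|lborel. LINT x|lborel. f x * g y * k x y) =
    (LINT x|lborel. LINT y|lborel. f x * g y * k x y)"
proof -
  have "integrable (lborel \<Otimes>\<^sub>M lborel) (\<lambda>z. (case z of (x, y) \<Rightarrow> f x * g y) * case_prod k z)"
    using assms by (intro integrable_mult_bounded[where B=1] integrable_pair_mult)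
      (auto split: prod.splits)
  then show ?thesis
    by (intro lborel_pair.Fubini_integral) (simp add: case_prod_beta')
qed

section \<open>Gaussians and their Fourier transforms\<close>

text \<open>Rescaling by \<open>\<sigma>\<close> turns the integral into the characteristic function
  of the standard normal distribution at \<open>\<sigma> * \<theta>\<close>.\<close>

lemma integral_cis_normal_density:
  assumes "\<sigma> > 0"
  shows "(LINT t|lborel. complex_of_real (normal_density 0 \<sigma> t) * cis (\<theta> * t)) = exp (- (\<sigma> * \<theta>)\<^sup>2 / 2)"
proof -
  have "(LINT t|lborel. complex_of_real (normal_density 0 \<sigma> t) * cis (\<theta> * t))
      = \<sigma> *\<^sub>R (LINT t|lborel. complex_of_real (normal_density 0 \<sigma> (0 + \<sigma> * t)) * cis (\<theta> * (0 + \<sigma> * t)))"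
    using assms by (subst lborel_integral_real_affine[where c=\<sigma> and t=0]) auto
  also have "\<dots> = (LINT t|lborel. std_normal_density t *\<^sub>R cis (\<sigma> * \<theta> * t))"
  proof -
    have "\<sigma> * normal_density 0 \<sigma> (\<sigma> * t) = std_normal_density t" for t
      using assms by (simp add: normal_density_def real_sqrt_mult power_mult_distrib)
    then have "\<sigma> *\<^sub>R (complex_of_real (normal_density 0 \<sigma> (\<sigma> * t)) * z) = std_normal_density t *\<^sub>R z" for t z
      by (metis scaleR_conv_of_real scaleR_scaleR)
    then show ?thesis
      by (subst integral_scaleR_right[symmetric]) (simp add: mult_ac)
  qed
  also have "\<dots> = char std_normal_distribution (\<sigma> * \<theta>)"
    unfolding char_def by (subst integral_density) (auto simp: cis_conv_exp)
  also have "\<dots> = exp (- (\<sigma> * \<theta>)\<^sup>2 / 2)"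
    by (simp add: char_std_normal_distribution)
  finally show ?thesis .
qed

definition gauss :: "real \<Rightarrow> real \<Rightarrow> complex" where
  "gauss \<sigma> t = complex_of_real (normal_density 0 \<sigma> t)"

text \<open>The characteristic function of the centred normal law of deviation
  \<open>\<sigma>\<close>, taken at \<open>-2 * pi * u\<close>, hence the Fourier transform of
  \<open>gauss \<sigma>\<close>. The closed form shows at once that it is positive and at most
  1.\<close>

definition gauss_hat :: "real \<Rightarrow> real \<Rightarrow> complex" where
  "gauss_hat \<sigma> u = complex_of_real (exp (- 2 * pi\<^sup>2 * \<sigma>\<^sup>2 * u\<^sup>2))"

lemma gauss_measurable [measurable]: "gauss \<sigma> \<in> borel_measurable borel"
  unfolding gauss_def[abs_def] by measurable

lemma gauss_integrable [simp]: "\<sigma> > 0 \<Longrightarrow> integrable lborel (gauss \<sigma>)"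
  unfolding gauss_def[abs_def] by (intro integrable_of_real integrable_normal_density)

lemma cmod_gauss [simp]: "cmod (gauss \<sigma> t) = normal_density 0 \<sigma> t"
  by (simp add: gauss_def)

lemma gauss_minus: "gauss \<sigma> (x - y) = gauss \<sigma> (y - x)"
  by (simp add: gauss_def normal_density_def power2_commute)

lemma gauss_hat_measurable [measurable]: "gauss_hat \<sigma> \<in> borel_measurable borel"
  unfolding gauss_hat_def[abs_def] by measurable

lemma cmod_gauss_hat_le: "cmod (gauss_hat \<sigma> u) \<le> 1"
  by (simp add: gauss_hat_def)

lemma fourier_gauss: "\<sigma> > 0 \<Longrightarrow> fourier (gauss \<sigma>) u = gauss_hat \<sigma> u"
  using integral_cis_normal_density[of \<sigma> "-2 * pi * u"]
  by (simp add: fourier_def gauss_def gauss_hat_def mult_ac power_mult_distrib)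

text \<open>Up to a constant the transform is again a Gaussian, of width
  \<open>1 / (2 * pi * \<sigma>)\<close>. Integrability and the inverse transform thus reduce to
  what is known for \<open>gauss\<close>.\<close>

lemma gauss_hat_eq_gauss:
  assumes "\<sigma> > 0"
  shows "gauss_hat \<sigma> u = complex_of_real (1 / (sqrt (2 * pi) * \<sigma>)) * gauss (1 / (2 * pi * \<sigma>)) u"
proof -
  have "sqrt (2 * pi * (1 / (2 * pi * \<sigma>))\<^sup>2) = 1 / (sqrt (2 * pi) * \<sigma>)"
  proof (rule real_sqrt_unique)
    have "(sqrt (2 * pi))\<^sup>2 = 2 * pi" by simp
    then show "(1 / (sqrt (2 * pi) * \<sigma>))\<^sup>2 = 2 * pi * (1 / (2 * pi * \<sigma>))\<^sup>2"
      using assms by (simp add: power_divide power_mult_distrib) (simp add: power2_eq_square)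
  qed (use assms in simp)
  moreover have "- u\<^sup>2 / (2 * (1 / (2 * pi * \<sigma>))\<^sup>2) = - 2 * pi\<^sup>2 * \<sigma>\<^sup>2 * u\<^sup>2"
    using assms by (simp add: field_simps power2_eq_square)
  ultimately show ?thesis
    using assms by (simp add: gauss_hat_def gauss_def normal_density_def)
qed

lemma gauss_hat_integrable [simp]: "\<sigma> > 0 \<Longrightarrow> integrable lborel (gauss_hat \<sigma>)"
  using gauss_hat_eq_gauss[of \<sigma>] by (subst ext[of "gauss_hat \<sigma>"]) auto

text \<open>Fourier inversion for this one function, by direct computation; every later use of
  inversion rests on it.\<close>

lemma fourier_gauss_hat:
  assumes "\<sigma> > 0"
  shows "(LINT u|lborel. gauss_hat \<sigma> u * cis (2 * pi * t * u)) = gauss \<sigma> t"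
proof -
  define \<tau> where "\<tau> = 1 / (2 * pi * \<sigma>)"
  have "\<tau> > 0" using assms by (simp add: \<tau>_def)
  have "(LINT u|lborel. gauss_hat \<sigma> u * cis (2 * pi * t * u))
     = complex_of_real (1 / (sqrt (2 * pi) * \<sigma>)) * (LINT u|lborel. gauss \<tau> u * cis (2 * pi * t * u))"
    unfolding gauss_hat_eq_gauss[OF assms] \<tau>_def mult.assoc by (rule integral_mult_right_zero)
  also have "\<dots> = complex_of_real (1 / (sqrt (2 * pi) * \<sigma>) * exp (- (\<tau> * (2 * pi * t))\<^sup>2 / 2))"
    unfolding gauss_def integral_cis_normal_density[OF \<open>\<tau> > 0\<close>] by simp
  also have "- (\<tau> * (2 * pi * t))\<^sup>2 / 2 = - t\<^sup>2 / (2 * \<sigma>\<^sup>2)"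
    using assms by (simp add: \<tau>_def field_simps power2_eq_square)
  finally show ?thesis
    using assms by (simp add: gauss_def normal_density_def real_sqrt_mult)
qed

section \<open>Gaussian regularization of an integrable function\<close>

definition gauss_conv :: "real \<Rightarrow> (real \<Rightarrow> complex) \<Rightarrow> real \<Rightarrow> complex" where
  "gauss_conv \<sigma> h t = (LINT x|lborel. h x * gauss \<sigma> (t - x))"

lemma gauss_conv_measurable [measurable]:
  assumes [measurable]: "h \<in> borel_measurable borel"
  shows "gauss_conv \<sigma> h \<in> borel_measurable borel"
  unfolding gauss_conv_def[abs_def] by measurable

context
  fixes \<sigma> :: real and h :: "real \<Rightarrow> complex"
  assumes \<sigma>: "\<sigma> > 0" and h: "integrable lborel h"
begin

lemma integral_gauss_shift: "(LINT t|lborel. normal_density 0 \<sigma> (t - x)) = 1"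
  using lborel_integral_real_affine[of 1 "normal_density 0 \<sigma>" "-x"] by (simp add: \<sigma>)

lemma integrable_gauss_shift: "integrable lborel (\<lambda>t. gauss \<sigma> (t - x))"
  using lborel_integrable_real_affine[of "gauss \<sigma>" 1 "-x"] \<sigma> by simp

lemma gauss_conv_kernel_integrable:
  "integrable (lborel \<Otimes>\<^sub>M lborel) (\<lambda>(x, t). h x * gauss \<sigma> (t - x))"
proof (rule lborel_pair.Fubini_integrable)
  note [measurable] = borel_measurable_integrable[OF h]
  show "(\<lambda>(x, t). h x * gauss \<sigma> (t - x)) \<in> borel_measurable (lborel \<Otimes>\<^sub>M lborel)"
    by measurable
  show "integrable lborel (\<lambda>x. LINT t|lborel. norm (case (x, t) of (x, t) \<Rightarrow> h x * gauss \<sigma> (t - x)))"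
    using h by (simp add: norm_mult integral_gauss_shift)
  show "AE x in lborel. integrable lborel (\<lambda>t. case (x, t) of (x, t) \<Rightarrow> h x * gauss \<sigma> (t - x))"
    by (simp add: integrable_gauss_shift)
qed

lemma gauss_conv_integrable: "integrable lborel (gauss_conv \<sigma> h)"
  unfolding gauss_conv_def[abs_def]
  by (rule lborel_pair.integrable_snd[OF gauss_conv_kernel_integrable])

text \<open>The factor \<open>gauss_hat \<sigma> u\<close> makes the double integral absolutely
  convergent, which it need not be for \<open>fourier h\<close> alone. Fubini then leaves the
  explicit inverse transform of a Gaussian as inner integral.\<close>

lemma gauss_conv_eq_inverse_fourier:
  "gauss_conv \<sigma> h t = (LINT u|lborel. fourier h u * gauss_hat \<sigma> u * cis (2 * pi * t * u))"
proof -
  have "(LINT u|lborel. fourier h u * gauss_hat \<sigma> u * cis (2 * pi * t * u))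
    = (LINT u|lborel. LINT x|lborel. h x * gauss_hat \<sigma> u * cis (2 * pi * (t - x) * u))"
  proof (intro Bochner_Integration.integral_cong refl)
    fix u
    have "cis (- 2 * pi * x * u) * cis (2 * pi * t * u) = cis (2 * pi * (t - x) * u)" for x
      by (simp add: cis_mult algebra_simps)
    then have eq: "h x * gauss_hat \<sigma> u * cis (2 * pi * (t - x) * u) =
        h x * cis (- 2 * pi * x * u) * (gauss_hat \<sigma> u * cis (2 * pi * t * u))" for x
      by (metis mult.assoc mult.commute mult.left_commute)
    show "fourier h u * gauss_hat \<sigma> u * cis (2 * pi * t * u)
      = (LINT x|lborel. h x * gauss_hat \<sigma> u * cis (2 * pi * (t - x) * u))"
      unfolding fourier_def eq Bochner_Integration.integral_mult_left_zero by (simp only: mult.assoc)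
  qed
  also have "\<dots> = (LINT x|lborel. LINT u|lborel. h x * gauss_hat \<sigma> u * cis (2 * pi * (t - x) * u))"
    using h \<sigma> by (intro Fubini_bounded_kernel) auto
  also have "\<dots> = gauss_conv \<sigma> h t"
    unfolding gauss_conv_def fourier_gauss_hat[OF \<sigma>, symmetric] by (simp add: mult.assoc)
  finally show ?thesis by simp
qed

lemma fourier_gauss_conv: "fourier (gauss_conv \<sigma> h) u = fourier h u * gauss_hat \<sigma> u"
proof -
  have i: "integrable (lborel \<Otimes>\<^sub>M lborel) (\<lambda>z. (case z of (x, t) \<Rightarrow> h x * gauss \<sigma> (t - x)) * cis (-2 * pi * snd z * u))"
    by (intro integrable_mult_bounded[where B=1] gauss_conv_kernel_integrable) auto
  have "fourier (gauss_conv \<sigma> h) u = (LINT t|lborel. LINT x|lborel. h x * gauss \<sigma> (t - x) * cis (-2 * pi * t * u))"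
    unfolding fourier_def gauss_conv_def by simp
  also have "\<dots> = (LINT x|lborel. LINT t|lborel. h x * gauss \<sigma> (t - x) * cis (-2 * pi * t * u))"
    using i by (intro lborel_pair.Fubini_integral) (simp add: case_prod_beta')
  also have "\<dots> = (LINT x|lborel. h x * cis (-2 * pi * x * u) * gauss_hat \<sigma> u)"
  proof (intro Bochner_Integration.integral_cong refl)
    fix x
    have "(LINT t|lborel. gauss \<sigma> (t - x) * cis (-2 * pi * t * u))
      = (LINT t|lborel. gauss \<sigma> t * cis (-2 * pi * (x + t) * u))"
      using lborel_integral_real_affine[of 1 "\<lambda>t. gauss \<sigma> (t - x) * cis (-2 * pi * t * u)" x] by simp
    also have "\<dots> = (LINT t|lborel. cis (-2 * pi * x * u) * (gauss \<sigma> t * cis (-2 * pi * t * u)))"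
    proof (intro Bochner_Integration.integral_cong refl)
      fix t
      have "cis (-2 * pi * (x + t) * u) = cis (-2 * pi * x * u) * cis (-2 * pi * t * u)"
        by (simp add: cis_mult algebra_simps)
      then show "gauss \<sigma> t * cis (-2 * pi * (x + t) * u) = cis (-2 * pi * x * u) * (gauss \<sigma> t * cis (-2 * pi * t * u))"
        by (simp only: mult_ac)
    qed
    also have "\<dots> = cis (-2 * pi * x * u) * gauss_hat \<sigma> u"
      unfolding fourier_gauss[OF \<sigma>, symmetric] fourier_def by (rule integral_mult_right_zero)
    finally show "(LINT t|lborel. h x * gauss \<sigma> (t - x) * cis (-2 * pi * t * u))
      = h x * cis (-2 * pi * x * u) * gauss_hat \<sigma> u"
      by (simp add: mult.assoc)
  qed
  also have "\<dots> = fourier h u * gauss_hat \<sigma> u"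
    unfolding fourier_def by simp
  finally show ?thesis .
qed

lemma cmod_gauss_conv_bound: "\<exists>B. \<forall>t. cmod (gauss_conv \<sigma> h t) \<le> B"
proof (intro exI allI)
  fix t
  have "normal_density 0 \<sigma> (t - x) \<le> normal_density 0 \<sigma> 0" for x
    using \<sigma> by (simp add: normal_density_def divide_right_mono)
  note n = this
  show "cmod (gauss_conv \<sigma> h t) \<le> (LINT x|lborel. cmod (h x) * normal_density 0 \<sigma> 0)"
    unfolding gauss_conv_def
  proof (rule Bochner_Integration.integral_norm_bound_integral)
    show "integrable lborel (\<lambda>x. h x * gauss \<sigma> (t - x))"
      using h n by (intro integrable_mult_bounded[where B="normal_density 0 \<sigma> 0"]) auto
  qed (use h n in \<open>auto simp: norm_mult intro!: mult_left_mono\<close>)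
qed

text \<open>The regularized function is both integrable and bounded, hence in L2, and so is its
  transform. Replacing one factor of its squared modulus by the inversion formula and exchanging the
  integrals turns the other factor into the conjugate of its transform.\<close>

lemma sqnorm_gauss_conv:
  "sqnorm lborel (gauss_conv \<sigma> h) = sqnorm lborel (\<lambda>u. fourier h u * gauss_hat \<sigma> u)"
proof -
  note [measurable] = borel_measurable_integrable[OF h]
  let ?C = "gauss_conv \<sigma> h" and ?G = "\<lambda>u. fourier h u * gauss_hat \<sigma> u"
  have G: "integrable lborel ?G"
    using integrable_mult_bounded[of lborel "gauss_hat \<sigma>" "fourier h" "LINT x|lborel. cmod (h x)"]
      cmod_fourier_le[OF h] \<sigma> by (simp add: mult.commute)
  note C = gauss_conv_integrable
  obtain B where B: "\<And>t. cmod (?C t) \<le> B" using cmod_gauss_conv_bound by auto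
  have iC: "integrable lborel (\<lambda>t. ?C t * cnj (?C t))"
    using B C by (intro integrable_mult_bounded[where B=B]) auto
  have iG: "integrable lborel (\<lambda>t. ?G t * cnj (?G t))"
  proof (rule integrable_mult_bounded[OF G])
    show "cmod (cnj (?G u)) \<le> (LINT x|lborel. cmod (h x))" for u
      using mult_mono[OF cmod_fourier_le[OF h] cmod_gauss_hat_le, of \<sigma> u u]
      by (simp add: norm_mult integral_nonneg_AE)
  qed measurable
  have "(LINT t|lborel. ?C t * cnj (?C t))
      = (LINT t|lborel. LINT u|lborel. ?G u * cnj (?C t) * cis (2 * pi * t * u))"
  proof (intro Bochner_Integration.integral_cong refl)
    fix t
    have "?C t * cnj (?C t) = (LINT u|lborel. ?G u * cis (2 * pi * t * u)) * cnj (?C t)"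
      by (simp only: gauss_conv_eq_inverse_fourier[symmetric])
    also have "\<dots> = (LINT u|lborel. ?G u * cis (2 * pi * t * u) * cnj (?C t))"
      by (rule Bochner_Integration.integral_mult_left_zero[symmetric])
    also have "\<dots> = (LINT u|lborel. ?G u * cnj (?C t) * cis (2 * pi * t * u))"
      by (simp only: mult_ac)
    finally show "?C t * cnj (?C t) = (LINT u|lborel. ?G u * cnj (?C t) * cis (2 * pi * t * u))" .
  qed
  also have "\<dots> = (LINT u|lborel. LINT t|lborel. ?G u * cnj (?C t) * cis (2 * pi * t * u))"
    using G C by (intro Fubini_bounded_kernel) auto
  also have "\<dots> = (LINT u|lborel. ?G u * cnj (fourier ?C u))"
    unfolding fourier_def[of ?C] Bochner_Integration.integral_cnj[symmetric]
    by (simp add: mult.assoc cis_cnj)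
  also have "\<dots> = (LINT u|lborel. ?G u * cnj (?G u))"
    unfolding fourier_gauss_conv ..
  finally have "(LINT t|lborel. ?C t * cnj (?C t)) = (LINT u|lborel. ?G u * cnj (?G u))" .
  then have "(LINT t|lborel. (cmod (?C t))\<^sup>2) = (LINT u|lborel. (cmod (?G u))\<^sup>2)"
    unfolding complex_norm_square[symmetric] integral_complex_of_real by simp
  moreover have "L2 lborel ?C" "L2 lborel ?G"
    using iC iG C G unfolding L2_def complex_norm_square[symmetric] complex_of_real_integrable_eq
    by auto
  ultimately show ?thesis by (simp add: sqnorm_eq_integral)
qed

lemma sqnorm_gauss_conv_le: "sqnorm lborel (gauss_conv \<sigma> h) \<le> sqnorm lborel h"
proof -
  note [measurable] = borel_measurable_integrable[OF h]
  let ?n = "normal_density 0 \<sigma>"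
  have one: "(\<integral>\<^sup>+t. ennreal (?n (t - x)) \<partial>lborel) = 1" for x
    using integrable_gauss_shift[of x, THEN integrable_norm] integral_gauss_shift[of x]
    by (subst nn_integral_eq_integral) auto
  have le: "ennreal ((cmod (gauss_conv \<sigma> h t))\<^sup>2) \<le> (\<integral>\<^sup>+x. ennreal ((cmod (h x))\<^sup>2 * ?n (t - x)) \<partial>lborel)" for t
  proof -
    \<comment> \<open>The kernel is split into two equal square roots for Cauchy-Schwarz: one goes
      with \<open>h\<close>, the other has square integral 1.\<close>
    let ?a = "\<lambda>x. ennreal (cmod (h x) * sqrt (?n (t - x)))" and ?b = "\<lambda>x. ennreal (sqrt (?n (t - x)))"
    have "integrable lborel (\<lambda>x. h x * gauss \<sigma> (t - x))"
      using h \<sigma> by (intro integrable_mult_bounded[where B="?n 0"])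
        (auto simp: normal_density_def divide_right_mono)
    then have "ennreal (cmod (gauss_conv \<sigma> h t)) \<le> (\<integral>\<^sup>+x. ennreal (cmod (h x) * ?n (t - x)) \<partial>lborel)"
      unfolding gauss_conv_def
      using integral_norm_bound_ennreal[of lborel "\<lambda>x. h x * gauss \<sigma> (t - x)"] by (simp add: norm_mult)
    also have "\<dots> = (\<integral>\<^sup>+x. ?a x * ?b x \<partial>lborel)"
      by (simp add: ennreal_mult[symmetric] mult.assoc)
    finally have "(ennreal (cmod (gauss_conv \<sigma> h t)))\<^sup>2 \<le> (\<integral>\<^sup>+x. ?a x * ?b x \<partial>lborel)\<^sup>2"
      by (intro power_mono) auto
    also have "\<dots> \<le> (\<integral>\<^sup>+x. (?a x)\<^sup>2 \<partial>lborel) * (\<integral>\<^sup>+x. (?b x)\<^sup>2 \<partial>lborel)"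
      by (intro Cauchy_Schwarz_nn_integral) measurable
    also have "(\<integral>\<^sup>+x. (?b x)\<^sup>2 \<partial>lborel) = 1"
      using one[of t] gauss_minus[of \<sigma> t] unfolding gauss_def of_real_eq_iff
      by (simp add: ennreal_power)
    finally show ?thesis
      by (simp add: ennreal_power power_mult_distrib)
  qed
  have "sqnorm lborel (gauss_conv \<sigma> h)
      \<le> (\<integral>\<^sup>+t. \<integral>\<^sup>+x. ennreal ((cmod (h x))\<^sup>2 * ?n (t - x)) \<partial>lborel \<partial>lborel)"
    unfolding sqnorm_def by (intro nn_integral_mono le)
  also have "\<dots> = (\<integral>\<^sup>+x. \<integral>\<^sup>+t. ennreal ((cmod (h x))\<^sup>2 * ?n (t - x)) \<partial>lborel \<partial>lborel)"
    by (rule lborel_pair.Fubini') measurable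
  also have "\<dots> = sqnorm lborel h"
    unfolding sqnorm_def by (simp add: ennreal_mult nn_integral_cmult one)
  finally show ?thesis .
qed

end

section \<open>Continuity of translation in L1\<close>

definition L1_shift :: "(real \<Rightarrow> complex) \<Rightarrow> real \<Rightarrow> real" where
  "L1_shift h s = (LINT x|lborel. cmod (h (x - s) - h x))"

lemma integrable_shift:
  fixes h :: "real \<Rightarrow> complex"
  shows "integrable lborel h \<Longrightarrow> integrable lborel (\<lambda>x. h (x - s))"
  using lborel_integrable_real_affine[of h 1 "-s"] by simp

lemma integral_shift:
  fixes h :: "real \<Rightarrow> 'a :: {banach, second_countable_topology}"
  shows "(LINT x|lborel. h (x - s)) = (LINT x|lborel. h x)"
  using lborel_integral_real_affine[of 1 h "-s"] by simp

lemma integrable_complex_indicator: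
  "A \<in> sets M \<Longrightarrow> emeasure M A < \<infinity> \<Longrightarrow> integrable M (indicator A :: 'a \<Rightarrow> complex)"
proof -
  assume A: "A \<in> sets M" "emeasure M A < \<infinity>"
  have "(\<lambda>x. indicator A x *\<^sub>R 1) = (indicator A :: 'a \<Rightarrow> complex)"
    by (auto simp: indicator_def)
  then show ?thesis
    using A integrable_scaleR_left[of "1 :: complex" M "indicator A"]
    by (simp add: integrable_indicator_iff)
qed

lemma L1_shift_measurable [measurable]:
  assumes [measurable]: "h \<in> borel_measurable borel"
  shows "L1_shift h \<in> borel_measurable borel"
  unfolding L1_shift_def[abs_def] by measurable

lemma L1_shift_nonneg: "0 \<le> L1_shift h s"
  by (simp add: L1_shift_def)

lemma L1_shift_le:
  assumes "integrable lborel h"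
  shows "L1_shift h s \<le> 2 * (LINT x|lborel. cmod (h x))"
proof -
  have "L1_shift h s \<le> (LINT x|lborel. cmod (h (x - s)) + cmod (h x))"
    unfolding L1_shift_def using assms
    by (intro integral_mono) (auto intro!: integrable_shift norm_triangle_ineq4)
  also have "\<dots> = (LINT x|lborel. cmod (h (x - s))) + (LINT x|lborel. cmod (h x))"
    using assms by (intro Bochner_Integration.integral_add) (auto intro!: integrable_shift)
  finally show ?thesis
    using integral_shift[of "\<lambda>x. cmod (h x)" s] by simp
qed

lemma L1_shift_add_le:
  assumes "integrable lborel h" "integrable lborel g"
  shows "L1_shift (\<lambda>x. h x + g x) s \<le> L1_shift h s + L1_shift g s"
proof -
  have i: "integrable lborel (\<lambda>x. cmod (h (x - s) - h x))" "integrable lborel (\<lambda>x. cmod (g (x - s) - g x))"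
    using assms by (auto intro!: integrable_shift)
  have "L1_shift (\<lambda>x. h x + g x) s
      \<le> (LINT x|lborel. cmod (h (x - s) - h x) + cmod (g (x - s) - g x))"
    unfolding L1_shift_def
  proof (rule integral_mono)
    show "integrable lborel (\<lambda>x. cmod (h (x - s) + g (x - s) - (h x + g x)))"
      using assms by (intro integrable_norm Bochner_Integration.integrable_diff
        Bochner_Integration.integrable_add integrable_shift)
  qed (use i in \<open>auto simp: add_diff_add norm_triangle_ineq\<close>)
  also have "\<dots> = L1_shift h s + L1_shift g s"
    unfolding L1_shift_def using i by simp
  finally show ?thesis .
qed

text \<open>The modulus is subadditive and at most twice the L1 norm, so smallness passes to L1
  limits. An approximation within \<open>e / 4\<close> costs at most \<open>e / 2\<close>, and the
  approximant contributes the other half.\<close>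

lemma L1_shift_limit:
  assumes h: "integrable lborel h"
    and s: "s \<longlonglongrightarrow> 0"
    and approx: "\<And>e. e > 0 \<Longrightarrow> \<exists>g. integrable lborel g \<and> (\<lambda>n. L1_shift g (s n)) \<longlonglongrightarrow> 0 \<and>
      (LINT x|lborel. cmod (h x - g x)) < e"
  shows "(\<lambda>n. L1_shift h (s n)) \<longlonglongrightarrow> 0"
proof (rule LIMSEQ_I)
  fix e :: real assume "e > 0"
  then obtain g where g: "integrable lborel g" "(\<lambda>n. L1_shift g (s n)) \<longlonglongrightarrow> 0"
    "(LINT x|lborel. cmod (h x - g x)) < e / 4"
    using approx[of "e / 4"] by auto
  from g(2) \<open>e > 0\<close> obtain N where N: "\<And>n. n \<ge> N \<Longrightarrow> L1_shift g (s n) < e / 2"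
    using LIMSEQ_D[of "\<lambda>n. L1_shift g (s n)" 0 "e / 2"] by (auto simp: L1_shift_nonneg)
  have "norm (L1_shift h (s n) - 0) < e" if "n \<ge> N" for n
  proof -
    have "L1_shift h (s n) \<le> L1_shift g (s n) + L1_shift (\<lambda>x. h x - g x) (s n)"
      using L1_shift_add_le[of g "\<lambda>x. h x - g x" "s n"] g(1) h by simp
    also have "L1_shift (\<lambda>x. h x - g x) (s n) \<le> 2 * (e / 4)"
      using L1_shift_le[of "\<lambda>x. h x - g x" "s n"] g(1,3) h by simp
    finally show ?thesis using N[OF that] by (simp add: L1_shift_nonneg)
  qed
  then show "\<exists>N. \<forall>n\<ge>N. norm (L1_shift h (s n) - 0) < e" by auto
qed

text \<open>A point of an open set stays in it after small translations, so the integrand is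
  eventually 0 at each point; \<open>indicator U\<close> dominates it.\<close>

lemma integral_open_minus_shift_tendsto_0:
  fixes U :: "real set"
  assumes U: "open U" and fin: "emeasure lborel U < \<infinity>" and s: "s \<longlonglongrightarrow> 0"
  shows "(\<lambda>n. LINT x|lborel. indicator U x * (1 - indicator U (x - s n)) :: real) \<longlonglongrightarrow> 0"
proof -
  have [measurable]: "U \<in> sets borel" using U by auto
  have "(\<lambda>n. LINT x|lborel. indicator U x * (1 - indicator U (x - s n)) :: real)
      \<longlonglongrightarrow> (LINT x|(lborel :: real measure). 0)"
  proof (rule integral_dominated_convergence[where w="indicator U"])
    show "integrable lborel (indicator U :: real \<Rightarrow> real)"
      using fin by (simp add: integrable_indicator_iff)
    show "AE x in lborel. (\<lambda>n. indicator U x * (1 - indicator U (x - s n)) :: real) \<longlonglongrightarrow> 0"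
    proof (rule AE_I2)
      fix x
      show "(\<lambda>n. indicator U x * (1 - indicator U (x - s n)) :: real) \<longlonglongrightarrow> 0"
      proof (cases "x \<in> U")
        case True
        have "(\<lambda>n. x - s n) \<longlonglongrightarrow> x" using tendsto_diff[OF tendsto_const s, of x] by simp
        then have "eventually (\<lambda>n. x - s n \<in> U) sequentially"
          using U True by (rule topological_tendstoD)
        then show ?thesis
          using True by (intro tendsto_eventually) (auto elim!: eventually_mono)
      qed simp
    qed
  qed (auto simp: indicator_def)
  then show ?thesis by simp
qed

text \<open>The symmetric difference of \<open>U\<close> and its translate splits into two one-sided
  pieces, and translating the second back gives the first with \<open>- t\<close>. Only points of
  \<open>U\<close> are then examined, which matters because the boundary of \<open>U\<close> may
  have positive measure and pointwise convergence may fail there.\<close>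

lemma L1_shift_open_tendsto_0:
  fixes U :: "real set"
  assumes U: "open U" and fin: "emeasure lborel U < \<infinity>" and s: "s \<longlonglongrightarrow> 0"
  shows "(\<lambda>n. L1_shift (indicator U) (s n)) \<longlonglongrightarrow> 0"
proof -
  have [measurable]: "U \<in> sets borel" using U by auto
  have iU: "integrable lborel (indicator U :: real \<Rightarrow> real)"
    using fin by (simp add: integrable_indicator_iff)
  define g where "g t = (LINT x|lborel. indicator U x * (1 - indicator U (x - t)) :: real)" for t
  have i: "integrable lborel (\<lambda>x. indicator U x * (1 - indicator U (x - t)) :: real)" for t
    by (rule Bochner_Integration.integrable_bound[OF iU]) (auto simp: indicator_def)
  have i': "integrable lborel (\<lambda>x. indicator U (x - t) * (1 - indicator U x) :: real)" for t
    using lborel_integrable_real_affine[OF i[of "-t"], of 1 "-t"] by simp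
  have "L1_shift (indicator U) t = g t + g (- t)" for t
  proof -
    have "L1_shift (indicator U) t = (LINT x|lborel. indicator U x * (1 - indicator U (x - t))
        + indicator U (x - t) * (1 - indicator U x))"
      unfolding L1_shift_def
      by (intro Bochner_Integration.integral_cong) (auto simp: indicator_def)
    also have "\<dots> = g t + (LINT x|lborel. indicator U (x - t) * (1 - indicator U x))"
      unfolding g_def by (rule Bochner_Integration.integral_add[OF i i'])
    also have "(LINT x|lborel. indicator U (x - t) * (1 - indicator U x)) = g (- t)"
      unfolding g_def
      using integral_shift[of "\<lambda>x. indicator U x * (1 - indicator U (x + t)) :: real" t] by simp
    finally show ?thesis .
  qed
  moreover have "(\<lambda>n. g (s n) + g (- s n)) \<longlonglongrightarrow> 0 + 0"
    unfolding g_def using s tendsto_minus[OF s]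
    by (intro tendsto_add integral_open_minus_shift_tendsto_0 U fin) auto
  ultimately show ?thesis by simp
qed

theorem L1_shift_tendsto_0:
  assumes "integrable lborel h" and s: "s \<longlonglongrightarrow> 0"
  shows "(\<lambda>n. L1_shift h (s n)) \<longlonglongrightarrow> 0"
  using assms(1)
proof (induct rule: integrable_induct)
  case (base A c)
  then have [measurable]: "A \<in> sets borel" by simp
  have ind: "(\<lambda>n. L1_shift (indicator A) (s n)) \<longlonglongrightarrow> 0"
  proof (rule L1_shift_limit[OF _ s])
    show "integrable lborel (indicator A :: real \<Rightarrow> complex)"
      using base by (simp add: integrable_complex_indicator)
    fix e :: real assume e: "e > 0"
    \<comment> \<open>Outer regularity reduces measurable sets of finite measure to open ones, up to
      \<open>e\<close> in L1.\<close>
    obtain U where U: "open U" "A \<subseteq> U" "emeasure lborel (U - A) < e"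
      using outer_regular_lborel[of A e] e by auto
    have [measurable]: "U \<in> sets borel" using U by auto
    have "emeasure lborel U = emeasure lborel A + emeasure lborel (U - A)"
      using U by (subst plus_emeasure) (auto simp: Un_absorb1)
    also have "\<dots> < \<infinity>" using base U by (auto simp: less_top[symmetric])
    finally have fin: "emeasure lborel U < \<infinity>" .
    have "(LINT x|lborel. cmod (indicator A x - indicator U x)) = (LINT x|lborel. indicator (U - A) x)"
      using U by (intro Bochner_Integration.integral_cong) (auto simp: indicator_def)
    also have "\<dots> < e"
      using U(3) e by (simp add: measure_def enn2real_less_iff less_top[symmetric])
        (metis enn2real_ennreal enn2real_less_iff ennreal_less_top less_eq_real_def order_less_trans)
    finally show "\<exists>g. integrable lborel g \<and> (\<lambda>n. L1_shift g (s n)) \<longlonglongrightarrow> 0 \<and>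
      (LINT x|lborel. cmod (indicator A x - g x)) < e"
      using fin L1_shift_open_tendsto_0[OF U(1) fin s]
      by (intro exI[of _ "indicator U"]) (simp add: integrable_complex_indicator)
  qed
  have "L1_shift (\<lambda>x. indicator A x *\<^sub>R c) t = cmod c * L1_shift (indicator A) t" for t
  proof -
    have "cmod (indicator A (x - t) *\<^sub>R c - indicator A x *\<^sub>R c)
        = cmod c * cmod (indicator A (x - t) - indicator A x)" for x
      by (auto simp: indicator_def)
    then show ?thesis by (simp add: L1_shift_def)
  qed
  then show ?case using tendsto_mult_right_zero[OF ind] by simp
next
  case (add f g)
  have "(\<lambda>n. L1_shift f (s n) + L1_shift g (s n)) \<longlonglongrightarrow> 0"
    using tendsto_add[OF add(2,4)] by simp
  then show ?case
    by (rule tendsto_sandwich[OF _ _ tendsto_const, rotated 2])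
      (auto simp: L1_shift_nonneg L1_shift_add_le add)
next
  case (lim f u)
  show ?case
  proof (rule L1_shift_limit[OF lim(5) s])
    fix e :: real assume e: "e > 0"
    note [measurable] = borel_measurable_integrable[OF lim(5)] borel_measurable_integrable[OF lim(1)]
    have "(\<lambda>i. LINT x|lborel. cmod (f x - u i x)) \<longlonglongrightarrow> (LINT x|(lborel :: real measure). 0)"
    \<comment> \<open>The approximants of the induction rule satisfy
      \<open>cmod (u i x) \<le> 2 * cmod (f x)\<close>, whence the constant 1 + 2 = 3.\<close>
    proof (rule integral_dominated_convergence[where w="\<lambda>x. 3 * cmod (f x)"])
      show "AE x in lborel. (\<lambda>i. cmod (f x - u i x)) \<longlonglongrightarrow> 0"
        using lim(3) by (intro AE_I2 tendsto_norm_zero) (auto intro!: tendsto_eq_intros)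
      show "AE x in lborel. norm (cmod (f x - u i x)) \<le> 3 * cmod (f x)" for i
      proof (rule AE_I2)
        fix x :: real
        show "norm (cmod (f x - u i x)) \<le> 3 * cmod (f x)"
          using norm_triangle_ineq4[of "f x" "u i x"] lim(4)[of x i] by simp
      qed
    qed (use lim(5) in auto)
    then obtain i where "(LINT x|lborel. cmod (f x - u i x)) < e"
      using e LIMSEQ_D[of "\<lambda>i. LINT x|lborel. cmod (f x - u i x)" 0 e] by auto
    then show "\<exists>g. integrable lborel g \<and> (\<lambda>n. L1_shift g (s n)) \<longlonglongrightarrow> 0 \<and>
      (LINT x|lborel. cmod (f x - g x)) < e"
      using lim(1,2) by blast
  qed
qed

section \<open>Gaussians as an approximate identity in L1\<close>

text \<open>Substituting \<open>x = t - \<sigma> * z\<close> moves \<open>\<sigma>\<close> from the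
  kernel into the translation, so one fixed density can dominate as \<open>\<sigma>\<close> tends to
  0.\<close>

lemma gauss_conv_rescaled:
  assumes "\<sigma> > 0" and h: "integrable lborel h"
  shows "gauss_conv \<sigma> h t = (LINT z|lborel. h (t - \<sigma> * z) * std_normal_density z)"
    "integrable lborel (\<lambda>z. h (t - \<sigma> * z) * std_normal_density z)"
proof -
  have eq: "\<sigma> *\<^sub>R (h (t - \<sigma> * z) * gauss \<sigma> (\<sigma> * z)) = h (t - \<sigma> * z) * std_normal_density z" for z
  proof -
    have "\<sigma> * normal_density 0 \<sigma> (\<sigma> * z) = std_normal_density z"
      using assms by (simp add: normal_density_def real_sqrt_mult power_mult_distrib)
    then show ?thesis
      by (simp add: gauss_def scaleR_conv_of_real mult_ac flip: of_real_mult)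
  qed
  show "gauss_conv \<sigma> h t = (LINT z|lborel. h (t - \<sigma> * z) * std_normal_density z)"
    unfolding gauss_conv_def eq[symmetric]
    using lborel_integral_real_affine[of "-\<sigma>" "\<lambda>x. h x * gauss \<sigma> (t - x)" t] assms(1) by simp
  have "integrable lborel (\<lambda>z. h (t + (-\<sigma>) * z))"
    using assms by (intro lborel_integrable_real_affine) auto
  then have "integrable lborel (\<lambda>z. h (t - \<sigma> * z))" by simp
  then show "integrable lborel (\<lambda>z. h (t - \<sigma> * z) * std_normal_density z)"
  proof (rule integrable_mult_bounded)
    show "cmod (complex_of_real (std_normal_density z)) \<le> std_normal_density 0" for z
      unfolding norm_of_real by (simp add: normal_density_def divide_right_mono)
  qed measurable
qed

text \<open>Minkowski's integral inequality: the regularization is an average of translates, so its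
  L1 error is at most the average of their L1 errors. Tonelli in extended nonnegative integrals
  performs the exchange.\<close>

lemma L1_gauss_conv_diff_le:
  assumes "\<sigma> > 0" and h: "integrable lborel h"
  shows "(LINT t|lborel. cmod (gauss_conv \<sigma> h t - h t)) \<le>
    (LINT z|lborel. std_normal_density z * L1_shift h (\<sigma> * z))"
proof -
  have [measurable]: "h \<in> borel_measurable borel" using h by auto
  have pt: "ennreal (cmod (gauss_conv \<sigma> h t - h t))
      \<le> (\<integral>\<^sup>+z. ennreal (std_normal_density z) * ennreal (cmod (h (t - \<sigma> * z) - h t)) \<partial>lborel)" for t
  proof -
    have i: "integrable lborel (\<lambda>z. h t * complex_of_real (std_normal_density z))"
      by (intro integrable_mult_right integrable_of_real integrable_normal_density) simp
    \<comment> \<open>Unit mass writes \<open>h t\<close> as an average against the same density, so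
      that the difference becomes a single integral.\<close>
    have m: "(LINT z|lborel. h t * complex_of_real (std_normal_density z)) = h t"
      unfolding Bochner_Integration.integral_mult_right_zero integral_complex_of_real
        integral_normal_density[OF zero_less_one] by simp
    have eq: "gauss_conv \<sigma> h t - h t
        = (LINT z|lborel. h (t - \<sigma> * z) * std_normal_density z - h t * std_normal_density z)"
      using Bochner_Integration.integral_diff[OF gauss_conv_rescaled(2)[OF assms, of t] i]
      by (simp only: gauss_conv_rescaled(1)[OF assms] m)
    have "ennreal (cmod (gauss_conv \<sigma> h t - h t)) \<le> (\<integral>\<^sup>+z. ennreal (cmod (h (t - \<sigma> * z) * std_normal_density z
        - h t * std_normal_density z)) \<partial>lborel)"
      unfolding eq by (rule integral_norm_bound_ennreal[OF Bochner_Integration.integrable_diff[OF gauss_conv_rescaled(2)[OF assms, of t] i]])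
    also have "\<dots> = (\<integral>\<^sup>+z. ennreal (std_normal_density z) * ennreal (cmod (h (t - \<sigma> * z) - h t)) \<partial>lborel)"
    proof (rule nn_integral_cong)
      fix z
      have "cmod (h (t - \<sigma> * z) * std_normal_density z - h t * std_normal_density z)
          = std_normal_density z * cmod (h (t - \<sigma> * z) - h t)"
        unfolding left_diff_distrib[symmetric] by (simp add: norm_mult)
      then show "ennreal (cmod (h (t - \<sigma> * z) * std_normal_density z - h t * std_normal_density z))
          = ennreal (std_normal_density z) * ennreal (cmod (h (t - \<sigma> * z) - h t))"
        by (simp add: ennreal_mult)
    qed
    finally show ?thesis .
  qed
  have shift: "(\<integral>\<^sup>+t. ennreal (cmod (h (t - s) - h t)) \<partial>lborel) = ennreal (L1_shift h s)" for s
    unfolding L1_shift_def using integrable_shift[OF h] h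
    by (intro nn_integral_eq_integral) auto
  have int: "integrable lborel (\<lambda>z. std_normal_density z * L1_shift h (\<sigma> * z))"
  proof (rule Bochner_Integration.integrable_bound)
    show "integrable lborel (\<lambda>z. std_normal_density z * (2 * (LINT x|lborel. cmod (h x))))"
      by (intro integrable_mult_left integrable_normal_density) simp
    show "AE z in lborel. norm (std_normal_density z * L1_shift h (\<sigma> * z))
        \<le> norm (std_normal_density z * (2 * (LINT x|lborel. cmod (h x))))"
      using L1_shift_le[OF h] L1_shift_nonneg[of h]
      by (intro AE_I2) (auto simp: abs_mult intro!: mult_left_mono)
  qed measurable
  have "ennreal (LINT t|lborel. cmod (gauss_conv \<sigma> h t - h t))
      = (\<integral>\<^sup>+t. ennreal (cmod (gauss_conv \<sigma> h t - h t)) \<partial>lborel)"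
    using gauss_conv_integrable[OF assms] h by (intro nn_integral_eq_integral[symmetric]) auto
  also have "\<dots> \<le> (\<integral>\<^sup>+t. \<integral>\<^sup>+z. ennreal (std_normal_density z) * ennreal (cmod (h (t - \<sigma> * z) - h t)) \<partial>lborel \<partial>lborel)"
    by (intro nn_integral_mono pt)
  also have "\<dots> = (\<integral>\<^sup>+z. \<integral>\<^sup>+t. ennreal (std_normal_density z) * ennreal (cmod (h (t - \<sigma> * z) - h t)) \<partial>lborel \<partial>lborel)"
    by (rule lborel_pair.Fubini') measurable
  also have "\<dots> = (\<integral>\<^sup>+z. ennreal (std_normal_density z * L1_shift h (\<sigma> * z)) \<partial>lborel)"
    by (simp add: nn_integral_cmult shift ennreal_mult L1_shift_nonneg)
  also have "\<dots> = ennreal (LINT z|lborel. std_normal_density z * L1_shift h (\<sigma> * z))"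
    using int by (intro nn_integral_eq_integral) (auto simp: L1_shift_nonneg)
  finally show ?thesis
    by (subst (asm) ennreal_le_iff) (auto simp: L1_shift_nonneg intro!: integral_nonneg_AE)
qed

lemma gauss_conv_tendsto_L1:
  assumes h: "integrable lborel h" and \<sigma>: "\<And>n. \<sigma> n > 0" "\<sigma> \<longlonglongrightarrow> 0"
  shows "(\<lambda>n. LINT t|lborel. cmod (gauss_conv (\<sigma> n) h t - h t)) \<longlonglongrightarrow> 0"
proof -
  have [measurable]: "h \<in> borel_measurable borel" using h by auto
  have "(\<lambda>n. LINT z|lborel. std_normal_density z * L1_shift h (\<sigma> n * z))
      \<longlonglongrightarrow> (LINT z|(lborel :: real measure). 0)"
  proof (rule integral_dominated_convergence)
    show "integrable lborel (\<lambda>z. std_normal_density z * (2 * (LINT x|lborel. cmod (h x))))"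
      by (intro integrable_mult_left integrable_normal_density) simp
    show "AE z in lborel. norm (std_normal_density z * L1_shift h (\<sigma> n * z))
        \<le> std_normal_density z * (2 * (LINT x|lborel. cmod (h x)))" for n
      using L1_shift_le[OF h] L1_shift_nonneg[of h]
      by (intro AE_I2) (auto simp: abs_mult intro!: mult_left_mono)
    show "AE z in lborel. (\<lambda>n. std_normal_density z * L1_shift h (\<sigma> n * z)) \<longlonglongrightarrow> 0"
      using tendsto_mult_left_zero[OF \<sigma>(2)]
      by (intro AE_I2 tendsto_mult_right_zero L1_shift_tendsto_0[OF h])
  qed measurable
  then have "(\<lambda>n. LINT z|lborel. std_normal_density z * L1_shift h (\<sigma> n * z)) \<longlonglongrightarrow> 0" by simp
  then show ?thesis
    by (rule tendsto_sandwich[OF _ _ tendsto_const, rotated 2])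
      (auto intro!: always_eventually L1_gauss_conv_diff_le h \<sigma>)
qed

text \<open>Fatou for square norms, stated so that infinite values on either side are
  allowed.\<close>

lemma sqnorm_le_liminf:
  assumes [measurable]: "f \<in> borel_measurable M" "\<And>n. F n \<in> borel_measurable M"
    and lim: "AE x in M. (\<lambda>n. F n x) \<longlonglongrightarrow> f x"
  shows "sqnorm M f \<le> liminf (\<lambda>n. sqnorm M (F n))"
proof -
  have "sqnorm M f = (\<integral>\<^sup>+x. liminf (\<lambda>n. ennreal ((cmod (F n x))\<^sup>2)) \<partial>M)"
    unfolding sqnorm_def
  proof (rule nn_integral_cong_AE)
    show "AE x in M. ennreal ((cmod (f x))\<^sup>2) = liminf (\<lambda>n. ennreal ((cmod (F n x))\<^sup>2))"
      using lim
    proof eventually_elim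
      case (elim x)
      then have "(\<lambda>n. ennreal ((cmod (F n x))\<^sup>2)) \<longlonglongrightarrow> ennreal ((cmod (f x))\<^sup>2)"
        by (intro tendsto_ennrealI tendsto_power tendsto_norm)
      then show ?case by (rule lim_imp_Liminf[OF sequentially_bot, symmetric])
    qed
  qed
  also have "\<dots> \<le> liminf (\<lambda>n. sqnorm M (F n))"
    unfolding sqnorm_def by (intro nn_integral_liminf) measurable
  finally show ?thesis .
qed

text \<open>Both inequalities let \<open>\<sigma>\<close> tend to 0 in the identity for
  \<open>gauss_conv\<close>. For \<open>\<le>\<close>, \<open>gauss_hat\<close> tends to 1 and
  convolution with a Gaussian does not increase the L2 norm. For \<open>\<ge>\<close>, the
  convolutions tend to \<open>h\<close> and \<open>gauss_hat\<close> is at most 1.\<close>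

theorem sqnorm_fourier:
  assumes h: "integrable lborel h"
  shows "sqnorm lborel (fourier h) = sqnorm lborel h"
proof (rule antisym)
  have [measurable]: "h \<in> borel_measurable borel" using h by auto
  define \<sigma> where "\<sigma> n = 1 / real (Suc n)" for n
  have \<sigma>: "\<sigma> n > 0" "\<sigma> \<longlonglongrightarrow> 0" for n
    unfolding \<sigma>_def[abs_def] using LIMSEQ_inverse_real_of_nat by (auto simp: inverse_eq_divide)
  let ?G = "\<lambda>n u. fourier h u * gauss_hat (\<sigma> n) u"
  have "(\<lambda>n. ?G n u) \<longlonglongrightarrow> fourier h u" for u
  proof -
    have "(\<lambda>n. - 2 * pi\<^sup>2 * (\<sigma> n)\<^sup>2 * u\<^sup>2) \<longlonglongrightarrow> - 2 * pi\<^sup>2 * 0\<^sup>2 * u\<^sup>2"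
      by (intro tendsto_intros \<sigma>(2))
    then have "(\<lambda>n. gauss_hat (\<sigma> n) u) \<longlonglongrightarrow> complex_of_real (exp 0)"
      unfolding gauss_hat_def by (intro tendsto_of_real tendsto_exp) simp
    then show ?thesis using tendsto_mult[OF tendsto_const, of _ 1 sequentially "fourier h u"] by simp
  qed
  then have "sqnorm lborel (fourier h) \<le> liminf (\<lambda>n. sqnorm lborel (?G n))"
    by (intro sqnorm_le_liminf) auto
  also have "\<dots> \<le> liminf (\<lambda>n. sqnorm lborel h)"
    using sqnorm_gauss_conv_le[OF \<sigma>(1) h] sqnorm_gauss_conv[OF \<sigma>(1) h]
    by (intro Liminf_mono always_eventually) simp
  finally show "sqnorm lborel (fourier h) \<le> sqnorm lborel h"
    by (simp add: Liminf_const)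
  \<comment> \<open>L1 convergence gives pointwise convergence only almost everywhere along a
    subsequence, which is enough for Fatou.\<close>
  obtain r where r: "strict_mono r"
    "AE t in lborel. (\<lambda>n. gauss_conv (\<sigma> (r n)) h t - h t) \<longlonglongrightarrow> 0"
    using tendsto_L1_AE_subseq[of lborel "\<lambda>n t. gauss_conv (\<sigma> n) h t - h t"]
      gauss_conv_tendsto_L1[OF h \<sigma>] gauss_conv_integrable[OF \<sigma>(1) h] h by auto
  from r(2) have "AE t in lborel. (\<lambda>n. gauss_conv (\<sigma> (r n)) h t) \<longlonglongrightarrow> h t"
    by (simp add: LIM_zero_iff)
  then have "sqnorm lborel h \<le> liminf (\<lambda>n. sqnorm lborel (gauss_conv (\<sigma> (r n)) h))"
    by (intro sqnorm_le_liminf) auto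
  also have "\<dots> \<le> liminf (\<lambda>n. sqnorm lborel (fourier h))"
  proof (intro Liminf_mono always_eventually allI)
    fix n
    have "cmod (?G n u) \<le> cmod (fourier h u)" for n u
      using cmod_gauss_hat_le by (simp add: norm_mult mult_left_le)
    then have "sqnorm lborel (?G (r n)) \<le> sqnorm lborel (fourier h)"
      unfolding sqnorm_def by (intro nn_integral_mono ennreal_leI power_mono) auto
    then show "sqnorm lborel (gauss_conv (\<sigma> (r n)) h) \<le> sqnorm lborel (fourier h)"
      using sqnorm_gauss_conv[OF \<sigma>(1) h] by simp
  qed
  finally show "sqnorm lborel h \<le> sqnorm lborel (fourier h)"
    by (simp add: Liminf_const)
qed

section \<open>The partial Fourier transform\<close>

text \<open>Measurability proofs decompose pairs over \<open>borel \<Otimes>\<^sub>M borel\<close>,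
  whereas \<open>lborel\<close> on the plane carries \<open>borel\<close>; this passes between the
  two descriptions of the same sigma-algebra.\<close>

lemma borel_measurable_pair_iff:
  "f \<in> borel_measurable (borel \<Otimes>\<^sub>M borel) \<longleftrightarrow> f \<in> borel_measurable borel"
  for f :: "real \<times> real \<Rightarrow> 'a :: topological_space"
  unfolding borel_prod ..

lemmas borel_pairI = borel_measurable_pair_iff[THEN iffD2]

lemma nn_integral_lborel_prod:
  fixes f :: "real \<times> real \<Rightarrow> ennreal"
  assumes "f \<in> borel_measurable borel"
  shows "(\<integral>\<^sup>+z. f z \<partial>lborel) = (\<integral>\<^sup>+x. \<integral>\<^sup>+y. f (x, y) \<partial>lborel \<partial>lborel)"
    and "(\<integral>\<^sup>+z. f z \<partial>lborel) = (\<integral>\<^sup>+y. \<integral>\<^sup>+x. f (x, y) \<partial>lborel \<partial>lborel)"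
proof -
  have f: "f \<in> borel_measurable (lborel \<Otimes>\<^sub>M lborel)" using assms unfolding lborel_prod by simp
  show "(\<integral>\<^sup>+z. f z \<partial>lborel) = (\<integral>\<^sup>+x. \<integral>\<^sup>+y. f (x, y) \<partial>lborel \<partial>lborel)"
    using lborel.nn_integral_fst[OF f] unfolding lborel_prod by (rule sym)
  show "(\<integral>\<^sup>+z. f z \<partial>lborel) = (\<integral>\<^sup>+y. \<integral>\<^sup>+x. f (x, y) \<partial>lborel \<partial>lborel)"
    using lborel_pair.nn_integral_snd[OF f] unfolding lborel_prod by (rule sym)
qed

lemma sqnorm_prod:
  fixes f :: "real \<times> real \<Rightarrow> complex"
  assumes [measurable]: "f \<in> borel_measurable borel"
  shows "sqnorm lborel f = (\<integral>\<^sup>+x. sqnorm lborel (\<lambda>y. f (x, y)) \<partial>lborel)"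
    and "sqnorm lborel f = (\<integral>\<^sup>+y. sqnorm lborel (\<lambda>x. f (x, y)) \<partial>lborel)"
  using nn_integral_lborel_prod[of "\<lambda>z. ennreal ((cmod (f z))\<^sup>2)"] by (simp_all add: sqnorm_def)

lemma L2_slice_measurable:
  fixes f :: "real \<times> real \<Rightarrow> complex"
  assumes "f \<in> borel_measurable borel"
  shows "(\<lambda>y. f (x, y)) \<in> borel_measurable borel" "(\<lambda>x. f (x, y)) \<in> borel_measurable borel"
  by (rule measurable_compose[OF _ assms], measurable)+

lemma L2_slices:
  fixes f :: "real \<times> real \<Rightarrow> complex"
  assumes "L2 lborel f"
  shows "AE x in lborel. L2 lborel (\<lambda>y. f (x, y))" "AE y in lborel. L2 lborel (\<lambda>x. f (x, y))"
proof -
  have f: "f \<in> borel_measurable borel" "sqnorm lborel f \<noteq> \<infinity>"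
    using assms by (auto simp: L2_iff_sqnorm)
  note [measurable] = f(1) borel_pairI[OF f(1)]
  have "AE x in lborel. sqnorm lborel (\<lambda>y. f (x, y)) \<noteq> \<infinity>"
    using f(2) unfolding sqnorm_prod(1)[OF f(1)]
    by (intro nn_integral_PInf_AE) (auto simp: sqnorm_def)
  then show "AE x in lborel. L2 lborel (\<lambda>y. f (x, y))"
    using L2_slice_measurable[OF f(1)] by (auto simp: L2_iff_sqnorm less_top)
  have "AE y in lborel. sqnorm lborel (\<lambda>x. f (x, y)) \<noteq> \<infinity>"
    using f(2) unfolding sqnorm_prod(2)[OF f(1)]
    by (intro nn_integral_PInf_AE) (auto simp: sqnorm_def)
  then show "AE y in lborel. L2 lborel (\<lambda>x. f (x, y))"
    using L2_slice_measurable[OF f(1)] by (auto simp: L2_iff_sqnorm less_top)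
qed

lemma L2_inner_diff_right:
  assumes "L2 M f" "L2 M g" "L2 M k"
  shows "L2_inner M f (\<lambda>x. g x - k x) = L2_inner M f g - L2_inner M f k"
  unfolding L2_inner_def
  using L2_integrable_mult[OF assms(1,2)] L2_integrable_mult[OF assms(1,3)]
  by (simp add: right_diff_distrib)

section \<open>Square integrable functions supported in a vertical strip\<close>

text \<open>Bounded support in the first variable makes almost every slice integrable, so the
  partial transform is an actual integral. The class is closed under linear combinations and
  dilations and contains every truncation of an L2 function.\<close>

definition strip_L2 :: "(real \<times> real \<Rightarrow> complex) \<Rightarrow> bool" where
  "strip_L2 f \<longleftrightarrow> L2 lborel f \<and> (\<exists>R. \<forall>x y. R < \<bar>x\<bar> \<longrightarrow> f (x, y) = 0)"

lemma L2_bounded_support_integrable: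
  fixes f :: "real \<Rightarrow> complex"
  assumes "L2 lborel f" and R: "\<And>x. R < \<bar>x\<bar> \<Longrightarrow> f x = 0"
  shows "integrable lborel f"
proof (rule Bochner_Integration.integrable_bound)
  show "integrable lborel (\<lambda>x. indicator {-R..R} x + (cmod (f x))\<^sup>2)"
    using assms(1)
    by (intro Bochner_Integration.integrable_add)
      (simp_all add: L2_def integrable_indicator_iff emeasure_lborel_Icc_eq)
  \<comment> \<open>This replaces Cauchy-Schwarz on the interval: the 1 is paid for by the bounded
    support, the square by L2.\<close>
  have a: "a \<le> 1 + a\<^sup>2" for a :: real
    using sum_squares_bound[of a 1] zero_le_power2[of a] by (simp only: mult_1_right one_power2)
  have "cmod (f x) \<le> indicator {-R..R} x + (cmod (f x))\<^sup>2" for x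
    using a[of "cmod (f x)"] R[of x] by (cases "R < \<bar>x\<bar>") (auto simp: indicator_def)
  then show "AE x in lborel. norm (f x) \<le> norm (indicator {-R..R} x + (cmod (f x))\<^sup>2)"
    by (intro AE_I2) (smt (verit) real_norm_def)
qed (use assms in \<open>auto simp: L2_def\<close>)

lemma strip_L2_integrable_slices:
  assumes "strip_L2 f"
  shows "AE y in lborel. integrable lborel (\<lambda>x. f (x, y))"
proof -
  obtain R where R: "\<And>x y. R < \<bar>x\<bar> \<Longrightarrow> f (x, y) = 0" and f: "L2 lborel f"
    using assms by (auto simp: strip_L2_def)
  show ?thesis
    using L2_slices(2)[OF f] by eventually_elim (rule L2_bounded_support_integrable, use R in auto)
qed

definition partial_fourier :: "(real \<times> real \<Rightarrow> complex) \<Rightarrow> real \<times> real \<Rightarrow> complex" where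
  "partial_fourier f = (\<lambda>(\<xi>, y). fourier (\<lambda>x. f (x, y)) \<xi>)"

lemma borel_measurable_partial_fourier:
  assumes "f \<in> borel_measurable borel"
  shows "partial_fourier f \<in> borel_measurable borel"
proof -
  note [measurable] = borel_pairI[OF assms]
  have "partial_fourier f \<in> borel_measurable (borel \<Otimes>\<^sub>M borel)"
    unfolding partial_fourier_def fourier_def by measurable
  then show ?thesis by (rule borel_measurable_pair_iff[THEN iffD1])
qed

lemma strip_L2_L2: "strip_L2 f \<Longrightarrow> L2 lborel f" by (simp add: strip_L2_def)

lemma strip_L2_measurable: "strip_L2 f \<Longrightarrow> f \<in> borel_measurable borel"
  by (auto simp: strip_L2_def L2_def)

text \<open>Plancherel on almost every horizontal slice, integrated over \<open>y\<close>.\<close>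

lemma sqnorm_partial_fourier:
  assumes "strip_L2 f"
  shows "sqnorm lborel (partial_fourier f) = sqnorm lborel f"
proof -
  have f: "f \<in> borel_measurable borel" using assms by (rule strip_L2_measurable)
  have "sqnorm lborel (partial_fourier f) = (\<integral>\<^sup>+y. sqnorm lborel (fourier (\<lambda>x. f (x, y))) \<partial>lborel)"
    unfolding sqnorm_prod(2)[OF borel_measurable_partial_fourier[OF f]] by (simp add: partial_fourier_def)
  also have "\<dots> = (\<integral>\<^sup>+y. sqnorm lborel (\<lambda>x. f (x, y)) \<partial>lborel)"
    using strip_L2_integrable_slices[OF assms]
    by (intro nn_integral_cong_AE) (auto simp: sqnorm_fourier)
  finally show ?thesis by (simp add: sqnorm_prod(2)[OF f])
qed

lemma L2_partial_fourier: "strip_L2 f \<Longrightarrow> L2 lborel (partial_fourier f)"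
  using sqnorm_partial_fourier[of f] borel_measurable_partial_fourier[of f]
  by (auto simp: strip_L2_def L2_iff_sqnorm)

lemma strip_L2_add_scale:
  assumes "strip_L2 f" "strip_L2 g"
  shows "strip_L2 (\<lambda>z. f z + c * g z)"
proof -
  obtain R S where R: "\<And>x y. R < \<bar>x\<bar> \<Longrightarrow> f (x, y) = 0" and S: "\<And>x y. S < \<bar>x\<bar> \<Longrightarrow> g (x, y) = 0"
    using assms unfolding strip_L2_def by blast
  have "\<forall>x y. max R S < \<bar>x\<bar> \<longrightarrow> f (x, y) + c * g (x, y) = 0" by (simp add: R S)
  then show ?thesis
    using L2_add L2_scale assms unfolding strip_L2_def by blast
qed

lemma fourier_add_scale:
  assumes "integrable lborel f" "integrable lborel g"
  shows "fourier (\<lambda>x. f x + c * g x) \<xi> = fourier f \<xi> + c * fourier g \<xi>"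
proof -
  have "fourier (\<lambda>x. f x + c * g x) \<xi>
      = (LINT x|lborel. f x * cis (-2 * pi * x * \<xi>) + c * (g x * cis (-2 * pi * x * \<xi>)))"
    unfolding fourier_def by (simp only: distrib_right mult.assoc)
  also have "\<dots> = fourier f \<xi> + c * fourier g \<xi>"
    unfolding fourier_def
    by (subst Bochner_Integration.integral_add)
      (use fourier_integrable[OF assms(1)] fourier_integrable[OF assms(2)] in \<open>simp_all only: integrable_mult_right integral_mult_right_zero\<close>)
  finally show ?thesis .
qed

text \<open>Additivity of the partial transform holds on slices where both functions are integrable,
  that is for almost every \<open>y\<close>. The norms in the polarization hypothesis are therefore
  compared under the integral over \<open>y\<close>.\<close>

lemma parseval_strip:
  assumes "strip_L2 f" "strip_L2 g"
  shows "L2_inner lborel (partial_fourier f) (partial_fourier g) = L2_inner lborel f g"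
proof (rule polarization(3))
  show "L2 lborel f" "L2 lborel g" using assms by (auto intro: strip_L2_L2)
  show m: "partial_fourier f \<in> borel_measurable lborel" "partial_fourier g \<in> borel_measurable lborel"
    using assms by (auto intro: borel_measurable_partial_fourier strip_L2_measurable)
  show "sqnorm lborel (partial_fourier g) = sqnorm lborel g"
    by (rule sqnorm_partial_fourier[OF assms(2)])
  fix c
  let ?k = "\<lambda>z. f z + c * g z"
  have k: "strip_L2 ?k" by (rule strip_L2_add_scale[OF assms])
  note m' = borel_measurable_partial_fourier[OF strip_L2_measurable]
  have "sqnorm lborel (\<lambda>z. partial_fourier f z + c * partial_fourier g z)
      = (\<integral>\<^sup>+y. sqnorm lborel (\<lambda>\<xi>. partial_fourier f (\<xi>, y) + c * partial_fourier g (\<xi>, y)) \<partial>lborel)"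
    using m by (intro sqnorm_prod) auto
  also have "\<dots> = (\<integral>\<^sup>+y. sqnorm lborel (\<lambda>\<xi>. partial_fourier ?k (\<xi>, y)) \<partial>lborel)"
  proof (rule nn_integral_cong_AE)
    show "AE y in lborel. sqnorm lborel (\<lambda>\<xi>. partial_fourier f (\<xi>, y) + c * partial_fourier g (\<xi>, y))
        = sqnorm lborel (\<lambda>\<xi>. partial_fourier ?k (\<xi>, y))"
      using strip_L2_integrable_slices[OF assms(1)] strip_L2_integrable_slices[OF assms(2)]
      by eventually_elim (simp add: partial_fourier_def fourier_add_scale)
  qed
  also have "\<dots> = sqnorm lborel ?k"
    using sqnorm_prod(2)[OF m'[OF k]] sqnorm_partial_fourier[OF k] by simp
  finally show "sqnorm lborel (\<lambda>z. partial_fourier f z + c * partial_fourier g z) = sqnorm lborel ?k" .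
qed

section \<open>Truncation, and Parseval for the Plancherel transform\<close>

definition strip_trunc :: "nat \<Rightarrow> (real \<times> real \<Rightarrow> complex) \<Rightarrow> real \<times> real \<Rightarrow> complex" where
  "strip_trunc n f = (\<lambda>(x, y). indicator {- real n..real n} x * f (x, y))"

lemma strip_trunc_bound: "cmod (strip_trunc n f z) \<le> cmod (f z)"
  by (cases z) (auto simp: strip_trunc_def indicator_def)

lemma strip_trunc_tendsto: "(\<lambda>n. strip_trunc n f z) \<longlonglongrightarrow> f z"
proof (rule tendsto_eventually)
  obtain x y where z: "z = (x, y)" by (cases z)
  obtain N where "\<bar>x\<bar> \<le> real N" using real_arch_simple by blast
  then have "strip_trunc n f z = f z" if "n \<ge> N" for n
    using that by (auto simp: strip_trunc_def z indicator_def)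
  then show "eventually (\<lambda>n. strip_trunc n f z = f z) sequentially"
    by (auto simp: eventually_sequentially)
qed

lemma strip_trunc_measurable:
  assumes "f \<in> borel_measurable borel"
  shows "strip_trunc n f \<in> borel_measurable borel"
proof -
  note [measurable] = borel_pairI[OF assms]
  have "strip_trunc n f \<in> borel_measurable (borel \<Otimes>\<^sub>M borel)"
    unfolding strip_trunc_def by measurable
  then show ?thesis by (rule borel_measurable_pair_iff[THEN iffD1])
qed

lemma strip_L2_trunc:
  assumes "L2 lborel f" shows "strip_L2 (strip_trunc n f)"
proof -
  have "strip_trunc n f \<in> borel_measurable lborel"
    using assms strip_trunc_measurable[of f n] by (simp add: L2_def)
  then have "L2 lborel (strip_trunc n f)"
    by (rule L2_bound[OF assms]) (rule strip_trunc_bound)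
  moreover have "\<forall>x y. real n < \<bar>x\<bar> \<longrightarrow> strip_trunc n f (x, y) = 0"
    by (auto simp: strip_trunc_def indicator_def)
  ultimately show ?thesis unfolding strip_L2_def by blast
qed

text \<open>The sequence that defines \<open>\<Psi>\<close> consists of partial transforms of strip
  functions, so \<open>parseval_strip\<close> applies to each of its terms.\<close>

lemma trunc_partial_FT_eq: "trunc_partial_FT n f = partial_fourier (strip_trunc n f)"
proof -
  have "indicator A x *\<^sub>R (a * b) = indicator A x * a * b" for A and x :: real and a b :: complex
    by (simp add: indicator_def)
  then show ?thesis
    unfolding trunc_partial_FT_def partial_fourier_def strip_trunc_def fourier_def
      set_lebesgue_integral_def by simp
qed

lemma L2_inner_trunc_tendsto:
  assumes f: "L2 lborel f" and g: "L2 lborel g"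
  shows "(\<lambda>n. L2_inner lborel (strip_trunc n f) g) \<longlonglongrightarrow> L2_inner lborel f g"
  unfolding L2_inner_def
proof (rule integral_dominated_convergence)
  show "(\<lambda>z. f z * cnj (g z)) \<in> borel_measurable lborel"
    by (rule borel_measurable_integrable[OF L2_integrable_mult[OF f g]])
  show "(\<lambda>z. strip_trunc n f z * cnj (g z)) \<in> borel_measurable lborel" for n
    by (rule borel_measurable_integrable[OF L2_integrable_mult[OF strip_L2_L2[OF strip_L2_trunc[OF f]] g]])
  show "integrable lborel (\<lambda>z. cmod (f z * cnj (g z)))"
    by (rule integrable_norm[OF L2_integrable_mult[OF f g]])
  show "AE z in lborel. (\<lambda>n. strip_trunc n f z * cnj (g z)) \<longlonglongrightarrow> f z * cnj (g z)"
    by (intro AE_I2 tendsto_mult tendsto_const strip_trunc_tendsto)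
  show "AE z in lborel. norm (strip_trunc n f z * cnj (g z)) \<le> cmod (f z * cnj (g z))" for n
    by (intro AE_I2) (simp add: norm_mult mult_right_mono strip_trunc_bound)
qed

text \<open>The pairing of \<open>f\<close> with truncations of \<open>\<psi>\<close> has two
  limits: on the space side by dominated convergence, and on the frequency side, after
  \<open>parseval_strip\<close>, by Cauchy-Schwarz and the L2 convergence to \<open>\<Psi>\<close>.
  The limits must agree.\<close>

theorem parseval_partial_FT:
  assumes f: "strip_L2 f" and \<psi>: "L2 lborel \<psi>" and \<Psi>: "is_partial_FT \<psi> \<Psi>"
  shows "L2_inner lborel f \<psi> = L2_inner lborel (partial_fourier f) \<Psi>"
proof -
  let ?F = "partial_fourier f"
  have F: "L2 lborel ?F" by (rule L2_partial_fourier[OF f])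
  have f2: "L2 lborel f" by (rule strip_L2_L2[OF f])
  have \<Psi>2: "L2 lborel \<Psi>" using \<Psi> unfolding is_partial_FT_def by blast
  define P where "P n = L2_inner lborel f (strip_trunc n \<psi>)" for n
  have "P \<longlonglongrightarrow> L2_inner lborel f \<psi>"
    unfolding P_def[abs_def] L2_inner_commute[of lborel f]
    by (rule tendsto_cnj[OF L2_inner_trunc_tendsto[OF \<psi> f2]])
  moreover have "P \<longlonglongrightarrow> L2_inner lborel ?F \<Psi>"
  proof -
    define D where "D n z = \<Psi> z - trunc_partial_FT n \<psi> z" for n z
    have D: "L2 lborel (D n)" for n
      using \<Psi> unfolding is_partial_FT_def D_def[abs_def] by blast
    have D0: "(\<lambda>n. LINT z|lborel. (cmod (D n z))\<^sup>2) \<longlonglongrightarrow> 0"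
      using \<Psi> unfolding is_partial_FT_def D_def[abs_def] by blast
    have diff: "L2_inner lborel ?F \<Psi> - P n = L2_inner lborel ?F (D n)" for n
    proof -
      have T: "L2 lborel (trunc_partial_FT n \<psi>)"
        unfolding trunc_partial_FT_eq by (rule L2_partial_fourier[OF strip_L2_trunc[OF \<psi>]])
      have "L2_inner lborel ?F (D n) = L2_inner lborel ?F \<Psi> - L2_inner lborel ?F (trunc_partial_FT n \<psi>)"
        unfolding D_def[abs_def] by (rule L2_inner_diff_right[OF F \<Psi>2 T])
      also have "L2_inner lborel ?F (trunc_partial_FT n \<psi>) = P n"
        unfolding P_def trunc_partial_FT_eq by (rule parseval_strip[OF f strip_L2_trunc[OF \<psi>]])
      finally show ?thesis by (rule sym)
    qed
    have sq: "(\<lambda>n. (cmod (L2_inner lborel ?F \<Psi> - P n))\<^sup>2) \<longlonglongrightarrow> 0"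
    proof (rule tendsto_sandwich[OF _ _ tendsto_const])
      let ?C = "LINT z|lborel. (cmod (?F z))\<^sup>2"
      show "(\<lambda>n. ?C * (LINT z|lborel. (cmod (D n z))\<^sup>2)) \<longlonglongrightarrow> 0"
        using tendsto_mult_right_zero[OF D0] .
      have "(cmod (L2_inner lborel ?F \<Psi> - P n))\<^sup>2 \<le> ?C * (LINT z|lborel. (cmod (D n z))\<^sup>2)" for n
      proof -
        have nn: "0 \<le> ?C" "0 \<le> (LINT z|lborel. (cmod (D n z))\<^sup>2)"
          by (rule integral_nonneg_AE, rule AE_I2, rule zero_le_power2)+
        have "ennreal ((cmod (L2_inner lborel ?F \<Psi> - P n))\<^sup>2)
            \<le> ennreal (?C * (LINT z|lborel. (cmod (D n z))\<^sup>2))"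
          using L2_inner_cauchy_schwarz[OF F D[of n]]
          unfolding diff sqnorm_eq_integral[OF F] sqnorm_eq_integral[OF D] ennreal_mult[OF nn] .
        then show ?thesis
          by (rule ennreal_le_iff[OF mult_nonneg_nonneg[OF nn], THEN iffD1])
      qed
      then show "\<forall>\<^sub>F n in sequentially. (cmod (L2_inner lborel ?F \<Psi> - P n))\<^sup>2
          \<le> ?C * (LINT z|lborel. (cmod (D n z))\<^sup>2)"
        by (rule eventuallyI)
      show "\<forall>\<^sub>F n in sequentially. 0 \<le> (cmod (L2_inner lborel ?F \<Psi> - P n))\<^sup>2"
        by (intro always_eventually allI zero_le_power2)
    qed
    have "(\<lambda>n. L2_inner lborel ?F \<Psi> - P n) \<longlonglongrightarrow> 0"
      using tendsto_real_sqrt[OF sq] by (subst tendsto_norm_zero_iff[symmetric]) simp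
    then have "(\<lambda>n. L2_inner lborel ?F \<Psi> - (L2_inner lborel ?F \<Psi> - P n)) \<longlonglongrightarrow> L2_inner lborel ?F \<Psi> - 0"
      by (intro tendsto_diff tendsto_const)
    then show ?thesis by simp
  qed
  ultimately show ?thesis by (rule LIMSEQ_unique)
qed

section \<open>The wavelet transform on the frequency side\<close>

lemma integral_lborel_prod:
  fixes f :: "real \<times> real \<Rightarrow> complex"
  assumes "integrable lborel f"
  shows "(LINT z|lborel. f z) = (LINT x|lborel. LINT y|lborel. f (x, y))"
    and "(LINT z|lborel. f z) = (LINT y|lborel. LINT x|lborel. f (x, y))"
    and "integrable lborel (\<lambda>x. LINT y|lborel. f (x, y))"
proof -
  have f: "integrable (lborel \<Otimes>\<^sub>M lborel) (\<lambda>(x, y). f (x, y))"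
    using assms unfolding lborel_prod by simp
  have f': "integrable (lborel \<Otimes>\<^sub>M lborel) f"
    using assms unfolding lborel_prod .
  show "(LINT z|lborel. f z) = (LINT x|lborel. LINT y|lborel. f (x, y))"
    using lborel_pair.integral_fst'[OF f'] unfolding lborel_prod by simp
  show "(LINT z|lborel. f z) = (LINT y|lborel. LINT x|lborel. f (x, y))"
    using lborel_pair.integral_snd[OF f] unfolding lborel_prod by simp
  show "integrable lborel (\<lambda>x. LINT y|lborel. f (x, y))"
    by (rule lborel_pair.integrable_fst'[OF f'])
qed

section \<open>Affine substitutions in the first variable\<close>

lemma measurable_affine_fst:
  fixes f :: "real \<times> real \<Rightarrow> 'a :: topological_space"
  assumes "f \<in> borel_measurable borel"
  shows "(\<lambda>z. f (t + c * fst z, snd z)) \<in> borel_measurable borel"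
proof (rule measurable_compose[OF _ assms])
  show "(\<lambda>z :: real \<times> real. (t + c * fst z, snd z)) \<in> borel \<rightarrow>\<^sub>M borel"
    by (intro borel_measurable_continuous_onI continuous_intros)
qed

lemma nn_integral_affine_fst:
  fixes f :: "real \<times> real \<Rightarrow> ennreal"
  assumes f: "f \<in> borel_measurable borel" and "c \<noteq> 0"
  shows "(\<integral>\<^sup>+z. f z \<partial>lborel) = ennreal \<bar>c\<bar> * (\<integral>\<^sup>+z. f (t + c * fst z, snd z) \<partial>lborel)"
proof -
  have m: "(\<lambda>x. f (x, y)) \<in> borel_measurable borel" for y
    by (rule measurable_compose[OF _ f]) measurable
  have g: "(\<lambda>z. f (t + c * fst z, snd z)) \<in> borel_measurable borel"
    by (rule measurable_affine_fst[OF f])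
  have g': "(\<lambda>z. f (t + c * fst z, snd z)) \<in> borel_measurable (borel \<Otimes>\<^sub>M borel)"
    by (rule borel_pairI[OF g])
  have "(\<integral>\<^sup>+z. f z \<partial>lborel) = (\<integral>\<^sup>+y. \<integral>\<^sup>+x. f (x, y) \<partial>lborel \<partial>lborel)"
    by (rule nn_integral_lborel_prod(2)[OF f])
  also have "\<dots> = (\<integral>\<^sup>+y. ennreal \<bar>c\<bar> * (\<integral>\<^sup>+x. f (t + c * x, y) \<partial>lborel) \<partial>lborel)"
    by (intro nn_integral_cong nn_integral_real_affine m assms)
  also have "\<dots> = ennreal \<bar>c\<bar> * (\<integral>\<^sup>+y. \<integral>\<^sup>+x. f (t + c * x, y) \<partial>lborel \<partial>lborel)"
  proof (rule nn_integral_cmult)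
    have "(\<lambda>(y, x). f (t + c * x, y)) \<in> borel_measurable (borel \<Otimes>\<^sub>M lborel)"
      using measurable_compose[OF measurable_pair_swap' g', unfolded split_beta] by (simp add: split_beta)
    then show "(\<lambda>y. \<integral>\<^sup>+x. f (t + c * x, y) \<partial>lborel) \<in> borel_measurable lborel"
      by (subst measurable_lborel2) (rule lborel.borel_measurable_nn_integral)
  qed
  also have "(\<integral>\<^sup>+y. \<integral>\<^sup>+x. f (t + c * x, y) \<partial>lborel \<partial>lborel) = (\<integral>\<^sup>+z. f (t + c * fst z, snd z) \<partial>lborel)"
    using nn_integral_lborel_prod(2)[OF g] by simp
  finally show ?thesis .
qed

lemma sqnorm_affine_fst:
  fixes f :: "real \<times> real \<Rightarrow> complex"
  assumes f: "f \<in> borel_measurable borel" and "c \<noteq> 0"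
  shows "sqnorm lborel f = ennreal \<bar>c\<bar> * sqnorm lborel (\<lambda>z. f (t + c * fst z, snd z))"
proof -
  have "(\<lambda>z. ennreal ((cmod (f z))\<^sup>2)) \<in> borel_measurable borel"
    using f by measurable
  from nn_integral_affine_fst[OF this assms(2)] show ?thesis
    unfolding sqnorm_def .
qed

lemma L2_affine_fst:
  fixes f :: "real \<times> real \<Rightarrow> complex"
  assumes "L2 lborel f" and "c \<noteq> 0"
  shows "L2 lborel (\<lambda>z. f (t + c * fst z, snd z))"
proof -
  have f: "f \<in> borel_measurable borel" using assms(1) by (simp add: L2_def)
  have "ennreal \<bar>c\<bar> * sqnorm lborel (\<lambda>z. f (t + c * fst z, snd z)) < \<infinity>"
    using assms(1) unfolding L2_iff_sqnorm sqnorm_affine_fst[OF f assms(2), of t] by blast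
  then have "sqnorm lborel (\<lambda>z. f (t + c * fst z, snd z)) < \<infinity>"
    using assms(2) by (auto simp: ennreal_mult_less_top ennreal_eq_0_iff)
  then show ?thesis
    using measurable_affine_fst[OF f] by (simp add: L2_iff_sqnorm)
qed

lemma integral_affine_fst:
  fixes f :: "real \<times> real \<Rightarrow> complex"
  assumes f: "integrable lborel f" and "c \<noteq> 0"
  shows "(LINT z|lborel. f z) = \<bar>c\<bar> *\<^sub>R (LINT z|lborel. f (t + c * fst z, snd z))"
    and "integrable lborel (\<lambda>z. f (t + c * fst z, snd z))"
proof -
  have fm: "f \<in> borel_measurable borel" using f by simp
  have "(\<lambda>z. ennreal (cmod (f z))) \<in> borel_measurable borel" using fm by measurable
  from nn_integral_affine_fst[OF this assms(2), of t]
  have "ennreal \<bar>c\<bar> * (\<integral>\<^sup>+z. ennreal (cmod (f (t + c * fst z, snd z))) \<partial>lborel) < \<infinity>"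
    using f unfolding integrable_iff_bounded by metis
  then have "(\<integral>\<^sup>+z. ennreal (cmod (f (t + c * fst z, snd z))) \<partial>lborel) < \<infinity>"
    using assms(2) by (auto simp: ennreal_mult_less_top ennreal_eq_0_iff)
  then show g: "integrable lborel (\<lambda>z. f (t + c * fst z, snd z))"
    using measurable_affine_fst[OF fm] by (simp add: integrable_iff_bounded)
  have "(LINT z|lborel. f z) = (LINT y|lborel. LINT x|lborel. f (x, y))"
    by (rule integral_lborel_prod(2)[OF f])
  also have "\<dots> = (LINT y|lborel. \<bar>c\<bar> *\<^sub>R (LINT x|lborel. f (t + c * x, y)))"
    by (intro Bochner_Integration.integral_cong refl lborel_integral_real_affine assms)
  also have "\<dots> = \<bar>c\<bar> *\<^sub>R (LINT y|lborel. LINT x|lborel. f (t + c * x, y))"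
    by (rule integral_scaleR_right)
  also have "(LINT y|lborel. LINT x|lborel. f (t + c * x, y)) = (LINT z|lborel. f (t + c * fst z, snd z))"
    using integral_lborel_prod(2)[OF g] by simp
  finally show "(LINT z|lborel. f z) = \<bar>c\<bar> *\<^sub>R (LINT z|lborel. f (t + c * fst z, snd z))" .
qed

section \<open>Dilations and translations on the frequency side\<close>

lemma psi_us_eq:
  "psi_us \<psi> (u, s) = (\<lambda>z. complex_of_real (s powr (-1/2)) * \<psi> (- u / s + 1 / s * fst z, snd z))"
  by (auto simp: psi_us_def diff_divide_distrib)

lemma L2_psi_us:
  assumes "L2 lborel \<psi>" "s > 0"
  shows "L2 lborel (psi_us \<psi> (u, s))"
  unfolding psi_us_eq using assms by (intro L2_scale L2_affine_fst) auto

text \<open>The inverse of the unitary map that takes \<open>\<psi>\<close> to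
  \<open>psi_us \<psi> (u, s)\<close>, for \<open>s > 0\<close>. Moving it onto \<open>f\<close>
  allows Parseval to be used with the given \<open>\<Psi>\<close>, without a partial transform of
  each \<open>psi_us\<close>.\<close>

definition dilate :: "real \<Rightarrow> real \<Rightarrow> (real \<times> real \<Rightarrow> complex) \<Rightarrow> real \<times> real \<Rightarrow> complex" where
  "dilate u s f = (\<lambda>z. complex_of_real (sqrt s) * f (u + s * fst z, snd z))"

lemma strip_L2_dilate:
  assumes "strip_L2 f" "s > 0"
  shows "strip_L2 (dilate u s f)"
proof -
  obtain R where R: "\<And>x y. R < \<bar>x\<bar> \<Longrightarrow> f (x, y) = 0"
    using assms unfolding strip_L2_def by blast
  \<comment> \<open>The radius is chosen so that
    \<open>\<bar>s * x\<bar> > R + \<bar>u\<bar>\<close>, which forces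
    \<open>\<bar>u + s * x\<bar> > R\<close>.\<close>
  have "dilate u s f (x, y) = 0" if "(R + \<bar>u\<bar>) / s < \<bar>x\<bar>" for x y
  proof -
    have "R + \<bar>u\<bar> < \<bar>s * x\<bar>"
      using that assms(2) by (simp add: abs_mult field_simps)
    then have "R < \<bar>u + s * x\<bar>" by linarith
    then show ?thesis by (simp add: dilate_def R)
  qed
  moreover have "L2 lborel (dilate u s f)"
    unfolding dilate_def using assms by (intro L2_scale L2_affine_fst) (auto intro: strip_L2_L2)
  ultimately show ?thesis unfolding strip_L2_def by blast
qed

lemma L2_inner_psi_us:
  assumes f: "strip_L2 f" and \<psi>: "L2 lborel \<psi>" and s: "s > 0"
  shows "L2_inner lborel f (psi_us \<psi> (u, s)) = L2_inner lborel (dilate u s f) \<psi>"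
proof -
  have i: "integrable lborel (\<lambda>z. dilate u s f z * cnj (\<psi> z))"
    by (rule L2_integrable_mult[OF strip_L2_L2[OF strip_L2_dilate[OF f s]] \<psi>])
  have pw: "s powr (-1/2) = 1 / sqrt s"
    using s by (simp add: powr_minus_divide powr_half_sqrt)
  have ss: "sqrt s * sqrt s = s" using s by simp
  have a: "\<bar>1 / s\<bar> = 1 / s" using s by simp
  have c: "complex_of_real (1 / s) * complex_of_real (sqrt s) = complex_of_real (1 / sqrt s)"
  proof -
    have "1 / s * sqrt s = 1 / sqrt s" using s ss by (simp add: field_simps)
    then show ?thesis by (simp only: of_real_mult[symmetric])
  qed
  have pt: "(1 / s) *\<^sub>R (dilate u s f (- u / s + 1 / s * fst z, snd z) * cnj (\<psi> (- u / s + 1 / s * fst z, snd z)))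
      = f z * cnj (psi_us \<psi> (u, s) z)" for z
  proof -
    have "u + s * (- u / s + 1 / s * fst z) = fst z" using s by (simp add: field_simps)
    then have "dilate u s f (- u / s + 1 / s * fst z, snd z) = complex_of_real (sqrt s) * f z"
      by (simp add: dilate_def)
    then show ?thesis
      unfolding psi_us_eq pw scaleR_conv_of_real complex_cnj_mult complex_cnj_complex_of_real
      by (simp only: c[symmetric] mult_ac)
  qed
  have "L2_inner lborel (dilate u s f) \<psi> = \<bar>1 / s\<bar> *\<^sub>R (LINT z|lborel.
      dilate u s f (- u / s + 1 / s * fst z, snd z) * cnj (\<psi> (- u / s + 1 / s * fst z, snd z)))"
    unfolding L2_inner_def using s by (intro integral_affine_fst(1)[OF i]) simp
  also have "\<dots> = (LINT z|lborel. (1 / s) *\<^sub>R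
      (dilate u s f (- u / s + 1 / s * fst z, snd z) * cnj (\<psi> (- u / s + 1 / s * fst z, snd z))))"
    unfolding a by (rule integral_scaleR_right[symmetric])
  also have "\<dots> = L2_inner lborel f (psi_us \<psi> (u, s))"
    unfolding L2_inner_def pt ..
  finally show ?thesis by (rule sym)
qed

text \<open>Affine substitution and extraction of a constant factor both respect the value 0 of the
  integral of a nonintegrable slice, so the identity holds at every \<open>y\<close>. Evaluation at
  \<open>s * \<xi>\<close> fits the later rescaling of the frequency.\<close>

lemma partial_fourier_dilate:
  assumes s: "s > 0"
  shows "partial_fourier (dilate u s f) (s * \<xi>, y)
    = complex_of_real (1 / sqrt s) * (cis (2 * pi * u * \<xi>) * partial_fourier f (\<xi>, y))"
proof -
  have pt: "f (u + s * x, y) * cis (- 2 * pi * (u + s * x) * \<xi>) * cis (2 * pi * u * \<xi>)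
      = f (u + s * x, y) * cis (- 2 * pi * x * (s * \<xi>))" for x
    unfolding mult.assoc[of "f _"] cis_mult by (simp add: algebra_simps)
  have "partial_fourier f (\<xi>, y) = (LINT x|lborel. f (x, y) * cis (- 2 * pi * x * \<xi>))"
    by (simp add: partial_fourier_def fourier_def)
  also have "\<dots> = \<bar>s\<bar> *\<^sub>R (LINT x|lborel. f (u + s * x, y) * cis (- 2 * pi * (u + s * x) * \<xi>))"
    using s by (intro lborel_integral_real_affine) simp
  finally have "partial_fourier f (\<xi>, y) * cis (2 * pi * u * \<xi>)
      = s *\<^sub>R ((LINT x|lborel. f (u + s * x, y) * cis (- 2 * pi * (u + s * x) * \<xi>)) * cis (2 * pi * u * \<xi>))"
    using s by simp
  also have "(LINT x|lborel. f (u + s * x, y) * cis (- 2 * pi * (u + s * x) * \<xi>)) * cis (2 * pi * u * \<xi>)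
      = (LINT x|lborel. f (u + s * x, y) * cis (- 2 * pi * x * (s * \<xi>)))"
    unfolding Bochner_Integration.integral_mult_left_zero[symmetric] pt ..
  finally have eq: "partial_fourier f (\<xi>, y) * cis (2 * pi * u * \<xi>)
      = complex_of_real s * (LINT x|lborel. f (u + s * x, y) * cis (- 2 * pi * x * (s * \<xi>)))"
    by (simp only: scaleR_conv_of_real)
  have "partial_fourier (dilate u s f) (s * \<xi>, y)
      = complex_of_real (sqrt s) * (LINT x|lborel. f (u + s * x, y) * cis (- 2 * pi * x * (s * \<xi>)))"
    unfolding partial_fourier_def fourier_def dilate_def prod.case fst_conv snd_conv mult.assoc[of "complex_of_real _"]
    by (rule Bochner_Integration.integral_mult_right_zero)
  moreover have "complex_of_real (1 / sqrt s) * complex_of_real s = complex_of_real (sqrt s)"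
    unfolding of_real_mult[symmetric] using s by (simp add: real_div_sqrt)
  ultimately show ?thesis
    unfolding mult.commute[of "cis _"] eq by (simp only: mult.assoc[symmetric])
qed

definition slice_pairing :: "(real \<times> real \<Rightarrow> complex) \<Rightarrow> (real \<times> real \<Rightarrow> complex) \<Rightarrow> real \<Rightarrow> real \<Rightarrow> complex" where
  "slice_pairing F \<Psi> \<xi> \<tau> = (LINT y|lborel. F (\<xi>, y) * cnj (\<Psi> (\<tau>, y)))"

text \<open>After Parseval, rescaling the frequency by \<open>s\<close> removes the dilation from
  \<open>f\<close> and leaves it on \<open>\<Psi>\<close>, with the translation as a phase. The
  Jacobian \<open>s\<close> and the factor \<open>1 / sqrt s\<close> combine to
  \<open>sqrt s\<close>.\<close>

lemma wavelet_transform_formula: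
  assumes f: "strip_L2 f" and \<psi>: "L2 lborel \<psi>" and \<Psi>: "is_partial_FT \<psi> \<Psi>" and s: "s > 0"
  defines "H \<equiv> (\<lambda>\<xi>. slice_pairing (partial_fourier f) \<Psi> \<xi> (s * \<xi>))"
  shows "integrable lborel H"
    and "L2_inner lborel f (psi_us \<psi> (u, s)) = complex_of_real (sqrt s) * fourier H (- u)"
proof -
  let ?F = "partial_fourier f"
  have F: "L2 lborel ?F" by (rule L2_partial_fourier[OF f])
  have \<Psi>2: "L2 lborel \<Psi>" using \<Psi> unfolding is_partial_FT_def by blast
  have \<Psi>s: "L2 lborel (\<lambda>z. \<Psi> (s * fst z, snd z))"
    using L2_affine_fst[OF \<Psi>2, of s 0] s by simp
  have FP: "integrable lborel (\<lambda>z. ?F z * cnj (\<Psi> (s * fst z, snd z)))"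
    by (rule L2_integrable_mult[OF F \<Psi>s])
  show "integrable lborel H"
    using integral_lborel_prod(3)[OF FP] by (simp add: H_def slice_pairing_def)
  let ?D = "partial_fourier (dilate u s f)"
  have D: "integrable lborel (\<lambda>z. ?D z * cnj (\<Psi> z))"
    by (rule L2_integrable_mult[OF L2_partial_fourier[OF strip_L2_dilate[OF f s]] \<Psi>2])
  have s0: "s \<noteq> 0" using s by simp
  have "L2_inner lborel f (psi_us \<psi> (u, s)) = L2_inner lborel ?D \<Psi>"
    unfolding L2_inner_psi_us[OF f \<psi> s]
    by (rule parseval_partial_FT[OF strip_L2_dilate[OF f s] \<psi> \<Psi>])
  also have "\<dots> = \<bar>s\<bar> *\<^sub>R (LINT z|lborel. ?D (0 + s * fst z, snd z) * cnj (\<Psi> (0 + s * fst z, snd z)))"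
    unfolding L2_inner_def by (rule integral_affine_fst(1)[OF D s0])
  also have "\<dots> = s *\<^sub>R (LINT z|lborel. complex_of_real (1 / sqrt s) *
      (?F z * cnj (\<Psi> (s * fst z, snd z)) * cis (2 * pi * u * fst z)))"
  proof -
    have "?D (0 + s * fst z, snd z) = complex_of_real (1 / sqrt s) * (cis (2 * pi * u * fst z) * ?F z)" for z
      using partial_fourier_dilate[OF s, of u f "fst z" "snd z"] by (simp only: add_0 prod.collapse)
    then have "?D (0 + s * fst z, snd z) * cnj (\<Psi> (0 + s * fst z, snd z)) = complex_of_real (1 / sqrt s) *
      (?F z * cnj (\<Psi> (s * fst z, snd z)) * cis (2 * pi * u * fst z))" for z
      by (simp only: add_0 mult_ac)
    then show ?thesis using s by (simp only: abs_of_pos)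
  qed
  also have "\<dots> = complex_of_real (s * (1 / sqrt s)) *
      (LINT z|lborel. ?F z * cnj (\<Psi> (s * fst z, snd z)) * cis (2 * pi * u * fst z))"
    unfolding Bochner_Integration.integral_mult_right_zero scaleR_conv_of_real of_real_mult mult.assoc ..
  also have "s * (1 / sqrt s) = sqrt s" using s by (simp add: real_div_sqrt)
  also have "(LINT z|lborel. ?F z * cnj (\<Psi> (s * fst z, snd z)) * cis (2 * pi * u * fst z)) = fourier H (- u)"
  proof -
    have "integrable lborel (\<lambda>z. ?F z * cnj (\<Psi> (s * fst z, snd z)) * cis (2 * pi * u * fst z))"
    proof (rule integrable_mult_bounded[OF FP])
      have "continuous_on UNIV (\<lambda>z :: real \<times> real. cis (2 * pi * u * fst z))"
        unfolding cis_conv_exp by (intro continuous_intros)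
      from borel_measurable_continuous_onI[OF this]
      show "(\<lambda>z :: real \<times> real. cis (2 * pi * u * fst z)) \<in> borel_measurable lborel"
        by simp
      show "cmod (cis (2 * pi * u * fst z)) \<le> 1" for z by simp
    qed
    from integral_lborel_prod(1)[OF this]
    have "(LINT z|lborel. ?F z * cnj (\<Psi> (s * fst z, snd z)) * cis (2 * pi * u * fst z))
        = (LINT \<xi>|lborel. LINT y|lborel. ?F (\<xi>, y) * cnj (\<Psi> (s * \<xi>, y)) * cis (2 * pi * u * \<xi>))"
      by (simp only: fst_conv snd_conv)
    also have "\<dots> = (LINT \<xi>|lborel. H \<xi> * cis (2 * pi * u * \<xi>))"
      unfolding H_def slice_pairing_def Bochner_Integration.integral_mult_left_zero ..
    \<comment> \<open>The inverse transform is written as the forward one at \<open>- u\<close>, so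
      that \<open>sqnorm_fourier\<close> applies after a reflection.\<close>
    also have "\<dots> = fourier H (- u)"
      unfolding fourier_def by (simp add: mult_ac)
    finally show ?thesis .
  qed
  finally show "L2_inner lborel f (psi_us \<psi> (u, s)) = complex_of_real (sqrt s) * fourier H (- u)" .
qed

section \<open>Slice maps and the invariant measure on the half line\<close>

definition slice_transform :: "(real \<times> real \<Rightarrow> complex) \<Rightarrow> real \<Rightarrow> (real \<Rightarrow> complex) \<Rightarrow> real \<Rightarrow> complex" where
  "slice_transform \<Psi> \<sigma> = (\<lambda>f s. LINT y|lborel. cnj (\<Psi> (\<sigma> * s, y)) * f y)"

text \<open>Unlike the signum it is -1 at 0, so it selects one of the two slice maps at every
  frequency.\<close>

definition half_sign :: "real \<Rightarrow> real" where
  "half_sign \<xi> = (if \<xi> > 0 then 1 else - 1)"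

lemma half_sign_mem: "half_sign \<xi> \<in> {1, -1}"
  by (simp add: half_sign_def)

text \<open>The sign of \<open>\<xi>\<close> selects the slice map, and its modulus acts only as a
  dilation of \<open>s\<close>, which the measure ds/s does not see.\<close>

lemma slice_transform_half_sign:
  assumes "\<xi> \<noteq> 0"
  shows "slice_transform \<Psi> (half_sign \<xi>) (\<lambda>y. F (\<xi>, y)) (\<bar>\<xi>\<bar> * s) = slice_pairing F \<Psi> \<xi> (s * \<xi>)"
proof -
  have "half_sign \<xi> * (\<bar>\<xi>\<bar> * s) = s * \<xi>" by (auto simp: half_sign_def)
  then show ?thesis
    unfolding slice_transform_def slice_pairing_def by (simp only: mult.commute[of "cnj _"])
qed

lemma slice_transform_measurable:
  assumes \<Psi>: "\<Psi> \<in> borel_measurable borel" and [measurable]: "f \<in> borel_measurable borel"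
  shows "slice_transform \<Psi> \<sigma> f \<in> borel_measurable borel"
proof -
  note [measurable] = borel_pairI[OF \<Psi>]
  show ?thesis unfolding slice_transform_def by measurable
qed

lemma sqnorm_half_line:
  assumes [measurable]: "g \<in> borel_measurable borel"
  shows "sqnorm half_line_ds_s g
    = (\<integral>\<^sup>+s. ennreal (if s > 0 then 1 / s else 0) * ennreal ((cmod (g s))\<^sup>2) \<partial>lborel)"
  unfolding sqnorm_def half_line_ds_s_def by (subst nn_integral_density) simp_all

text \<open>The measure ds/s is the Haar measure of the multiplicative group: the Jacobian
  \<open>a\<close> cancels against the density at \<open>a * s\<close>.\<close>

lemma sqnorm_half_line_scale:
  assumes g: "g \<in> borel_measurable borel" and a: "a > 0"
  shows "sqnorm half_line_ds_s g = sqnorm half_line_ds_s (\<lambda>s. g (a * s))"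
proof -
  note [measurable] = g
  let ?d = "\<lambda>s :: real. ennreal (if s > 0 then 1 / s else 0)"
  have d: "ennreal a * (?d (a * s) * b) = ?d s * b" for s b
  proof (cases "s > 0")
    case True
    then have "ennreal a * ?d (a * s) = ?d s"
      using a by (simp add: ennreal_mult[symmetric])
    then show ?thesis by (simp only: mult.assoc[symmetric])
  next
    case False
    then have "\<not> 0 < a * s" using a by (simp add: zero_less_mult_iff)
    then show ?thesis using False by simp
  qed
  have "sqnorm half_line_ds_s g = ennreal \<bar>a\<bar> * (\<integral>\<^sup>+s. ?d (0 + a * s) * ennreal ((cmod (g (0 + a * s)))\<^sup>2) \<partial>lborel)"
    unfolding sqnorm_half_line[OF g] using a by (intro nn_integral_real_affine) simp_all
  also have "\<dots> = (\<integral>\<^sup>+s. ennreal a * (?d (a * s) * ennreal ((cmod (g (a * s)))\<^sup>2)) \<partial>lborel)"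
    unfolding add_0_left using a by (subst nn_integral_cmult) simp_all
  also have "\<dots> = sqnorm half_line_ds_s (\<lambda>s. g (a * s))"
    unfolding d by (rule sqnorm_half_line[symmetric]) measurable
  finally show ?thesis .
qed

lemma fst_snd_borel_measurable [measurable]:
  "(fst :: real \<times> real \<Rightarrow> real) \<in> borel_measurable borel"
  "(snd :: real \<times> real \<Rightarrow> real) \<in> borel_measurable borel"
  by (intro borel_measurable_continuous_onI continuous_intros)+

lemma sets_param_measure [measurable_cong]: "sets param_measure = sets borel"
  by (simp add: param_measure_def)

lemma param_density_measurable:
  "(\<lambda>p :: real \<times> real. ennreal (if snd p > 0 then 1 / (snd p)\<^sup>2 else 0)) \<in> borel_measurable borel"
  by measurable

lemma sqnorm_param_measure:
  assumes G: "G \<in> borel_measurable borel"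
  shows "sqnorm param_measure G
    = (\<integral>\<^sup>+s. ennreal (if s > 0 then 1 / s\<^sup>2 else 0) * sqnorm lborel (\<lambda>u. G (u, s)) \<partial>lborel)"
proof -
  have m: "(\<lambda>p. ennreal ((cmod (G p))\<^sup>2)) \<in> borel_measurable borel" using G by measurable
  have m': "(\<lambda>u. ennreal ((cmod (G (u, s)))\<^sup>2)) \<in> borel_measurable lborel" for s
    using measurable_compose[OF _ m, of "\<lambda>u. (u, s)" lborel] by simp
  have "sqnorm param_measure G = (\<integral>\<^sup>+p. ennreal (if snd p > 0 then 1 / (snd p)\<^sup>2 else 0)
      * ennreal ((cmod (G p))\<^sup>2) \<partial>lborel)"
    unfolding sqnorm_def param_measure_def case_prod_beta'
    using param_density_measurable m by (intro nn_integral_density) simp_all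
  also have "\<dots> = (\<integral>\<^sup>+s. \<integral>\<^sup>+u. ennreal (if snd (u, s) > 0 then 1 / (snd (u, s))\<^sup>2 else 0)
      * ennreal ((cmod (G (u, s)))\<^sup>2) \<partial>lborel \<partial>lborel)"
    using param_density_measurable m
    by (intro nn_integral_lborel_prod(2) borel_measurable_times_ennreal)
  also have "\<dots> = (\<integral>\<^sup>+s. ennreal (if s > 0 then 1 / s\<^sup>2 else 0) * sqnorm lborel (\<lambda>u. G (u, s)) \<partial>lborel)"
    unfolding sqnorm_def snd_conv by (intro nn_integral_cong nn_integral_cmult m')
  finally show ?thesis .
qed

text \<open>\<open>L2_psi_us\<close> covers only \<open>s > 0\<close>; the rest of the plane is a
  null set for the parameter measure, so statements about the wavelet coefficients are made almost
  everywhere.\<close>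

lemma AE_param_measure_pos: "AE p in param_measure. snd p > 0"
proof -
  have "(\<lambda>p :: real \<times> real. ennreal (if snd p > 0 then 1 / (snd p)\<^sup>2 else 0)) \<in> borel_measurable lborel"
    using param_density_measurable by simp
  from AE_density[OF this, of "\<lambda>p. snd p > 0"] show ?thesis
    unfolding param_measure_def case_prod_beta' by (auto split: if_splits)
qed

lemma borel_measurable_wavelet:
  assumes f: "f \<in> borel_measurable borel" and \<psi>: "\<psi> \<in> borel_measurable borel"
  shows "(\<lambda>p. L2_inner lborel f (psi_us \<psi> p)) \<in> borel_measurable borel"
proof -
  have c: "(\<lambda>w :: (real \<times> real) \<times> (real \<times> real). ((fst (snd w) - fst (fst w)) / snd (fst w), snd (snd w)))
      \<in> borel \<Otimes>\<^sub>M borel \<rightarrow>\<^sub>M borel"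
    by measurable
  have "(\<lambda>w. f (snd w) * cnj (complex_of_real (snd (fst w) powr (-1/2))
      * \<psi> ((fst (snd w) - fst (fst w)) / snd (fst w), snd (snd w)))) \<in> borel_measurable (borel \<Otimes>\<^sub>M borel)"
    using measurable_compose[OF c \<psi>] measurable_compose[OF measurable_snd f]
    by measurable
  also have "(\<lambda>w. f (snd w) * cnj (complex_of_real (snd (fst w) powr (-1/2))
      * \<psi> ((fst (snd w) - fst (fst w)) / snd (fst w), snd (snd w))))
      = (\<lambda>(p, z). f z * cnj (psi_us \<psi> p z))"
    by (auto simp: psi_us_def)
  finally show ?thesis
    unfolding L2_inner_def by (intro lborel.borel_measurable_lebesgue_integral) simp
qed

lemma sqnorm_uminus:
  fixes h :: "real \<Rightarrow> complex"
  assumes [measurable]: "h \<in> borel_measurable borel"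
  shows "sqnorm lborel (\<lambda>u. h (- u)) = sqnorm lborel h"
  unfolding sqnorm_def
  using nn_integral_real_affine[of "\<lambda>u. ennreal ((cmod (h u))\<^sup>2)" "-1" 0] by simp

lemma sqnorm_wavelet_fixed_scale:
  assumes f: "strip_L2 f" and \<psi>: "L2 lborel \<psi>" and \<Psi>: "is_partial_FT \<psi> \<Psi>" and s: "s > 0"
  shows "sqnorm lborel (\<lambda>u. L2_inner lborel f (psi_us \<psi> (u, s)))
    = ennreal s * sqnorm lborel (\<lambda>\<xi>. slice_pairing (partial_fourier f) \<Psi> \<xi> (s * \<xi>))"
proof -
  define H where "H = (\<lambda>\<xi>. slice_pairing (partial_fourier f) \<Psi> \<xi> (s * \<xi>))"
  have iH: "integrable lborel H"
    unfolding H_def by (rule wavelet_transform_formula(1)[OF f \<psi> \<Psi> s])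
  note [measurable] = borel_measurable_integrable[OF iH]
  have "sqnorm lborel (\<lambda>u. L2_inner lborel f (psi_us \<psi> (u, s)))
      = sqnorm lborel (\<lambda>u. complex_of_real (sqrt s) * fourier H (- u))"
    unfolding wavelet_transform_formula(2)[OF f \<psi> \<Psi> s] H_def ..
  also have "\<dots> = ennreal ((cmod (complex_of_real (sqrt s)))\<^sup>2) * sqnorm lborel (\<lambda>u. fourier H (- u))"
    by (rule sqnorm_scale) measurable
  also have "(cmod (complex_of_real (sqrt s)))\<^sup>2 = s" using s by simp
  also have "sqnorm lborel (\<lambda>u. fourier H (- u)) = sqnorm lborel H"
    using sqnorm_uminus[of "fourier H"] sqnorm_fourier[OF iH] by simp
  finally show ?thesis unfolding H_def .
qed

theorem sqnorm_wavelet: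
  assumes f: "strip_L2 f" and \<psi>: "L2 lborel \<psi>" and \<Psi>: "is_partial_FT \<psi> \<Psi>"
  shows "sqnorm param_measure (\<lambda>p. L2_inner lborel f (psi_us \<psi> p)) =
    (\<integral>\<^sup>+\<xi>. sqnorm half_line_ds_s
      (slice_transform \<Psi> (half_sign \<xi>) (\<lambda>y. partial_fourier f (\<xi>, y))) \<partial>lborel)"
proof -
  let ?F = "partial_fourier f"
  let ?d = "\<lambda>s :: real. ennreal (if s > 0 then 1 / s else 0)"
  have Fm: "?F \<in> borel_measurable borel"
    by (rule borel_measurable_partial_fourier[OF strip_L2_measurable[OF f]])
  have \<Psi>m: "\<Psi> \<in> borel_measurable borel"
    using \<Psi> by (simp add: is_partial_FT_def L2_def)
  note [measurable] = borel_pairI[OF Fm] borel_pairI[OF \<Psi>m]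
  have K: "(\<lambda>(\<xi>, s). slice_pairing ?F \<Psi> \<xi> (s * \<xi>)) \<in> borel_measurable (borel \<Otimes>\<^sub>M borel)"
    unfolding slice_pairing_def by measurable
  note [measurable] = K
  have "sqnorm param_measure (\<lambda>p. L2_inner lborel f (psi_us \<psi> p)) =
      (\<integral>\<^sup>+s. ennreal (if s > 0 then 1 / s\<^sup>2 else 0)
        * sqnorm lborel (\<lambda>u. L2_inner lborel f (psi_us \<psi> (u, s))) \<partial>lborel)"
    using \<psi> strip_L2_measurable[OF f]
    by (intro sqnorm_param_measure borel_measurable_wavelet) (simp_all add: L2_def)
  also have "\<dots> = (\<integral>\<^sup>+s. ?d s * sqnorm lborel (\<lambda>\<xi>. slice_pairing ?F \<Psi> \<xi> (s * \<xi>)) \<partial>lborel)"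
  proof (rule nn_integral_cong)
    fix s :: real
    show "ennreal (if s > 0 then 1 / s\<^sup>2 else 0) * sqnorm lborel (\<lambda>u. L2_inner lborel f (psi_us \<psi> (u, s)))
      = ?d s * sqnorm lborel (\<lambda>\<xi>. slice_pairing ?F \<Psi> \<xi> (s * \<xi>))"
    proof (cases "s > 0")
      case True
      \<comment> \<open>The factor \<open>s\<close> from Plancherel at fixed scale turns
        ds/\<open>s\<^sup>2\<close> into ds/s.\<close>
      have "ennreal (1 / s\<^sup>2) * (ennreal s * b) = ennreal (1 / s) * b" for b
        using True by (simp add: mult.assoc[symmetric] ennreal_mult[symmetric] power2_eq_square)
      then show ?thesis
        using True by (simp only: sqnorm_wavelet_fixed_scale[OF f \<psi> \<Psi>] if_True)
    qed simp
  qed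
  also have "\<dots> = (\<integral>\<^sup>+s. \<integral>\<^sup>+\<xi>. ?d s * ennreal ((cmod (slice_pairing ?F \<Psi> \<xi> (s * \<xi>)))\<^sup>2) \<partial>lborel \<partial>lborel)"
    unfolding sqnorm_def by (intro nn_integral_cong nn_integral_cmult[symmetric]) measurable
  also have "\<dots> = (\<integral>\<^sup>+\<xi>. \<integral>\<^sup>+s. ?d s * ennreal ((cmod (slice_pairing ?F \<Psi> \<xi> (s * \<xi>)))\<^sup>2) \<partial>lborel \<partial>lborel)"
    by (rule lborel_pair.Fubini') measurable
  also have "\<dots> = (\<integral>\<^sup>+\<xi>. sqnorm half_line_ds_s
      (slice_transform \<Psi> (half_sign \<xi>) (\<lambda>y. ?F (\<xi>, y))) \<partial>lborel)"
  proof (rule nn_integral_cong_AE)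
    have "AE \<xi> in lborel. \<xi> \<noteq> (0 :: real)" by (rule AE_lborel_singleton)
    then show "AE \<xi> in lborel.
        (\<integral>\<^sup>+s. ?d s * ennreal ((cmod (slice_pairing ?F \<Psi> \<xi> (s * \<xi>)))\<^sup>2) \<partial>lborel)
        = sqnorm half_line_ds_s (slice_transform \<Psi> (half_sign \<xi>) (\<lambda>y. ?F (\<xi>, y)))"
    proof eventually_elim
      case (elim \<xi>)
      have m: "slice_transform \<Psi> (half_sign \<xi>) (\<lambda>y. ?F (\<xi>, y)) \<in> borel_measurable borel"
        by (intro slice_transform_measurable \<Psi>m L2_slice_measurable(1) Fm)
      have m': "(\<lambda>s. slice_pairing ?F \<Psi> \<xi> (s * \<xi>)) \<in> borel_measurable borel"
        by measurable
      \<comment> \<open>The dilation by \<open>\<bar>\<xi>\<bar>\<close> is absorbed by scale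
        invariance, which is possible because \<open>\<xi> \<noteq> 0\<close>.\<close>
      have "sqnorm half_line_ds_s (slice_transform \<Psi> (half_sign \<xi>) (\<lambda>y. ?F (\<xi>, y)))
          = sqnorm half_line_ds_s (\<lambda>s. slice_pairing ?F \<Psi> \<xi> (s * \<xi>))"
        using sqnorm_half_line_scale[OF m, of "\<bar>\<xi>\<bar>"] elim
        by (simp only: slice_transform_half_sign zero_less_abs_iff simp_thms)
      then show ?case using sqnorm_half_line[OF m'] by simp
    qed
  qed
  finally show ?thesis .
qed

section \<open>Isometries\<close>

lemma wavelet_add_scale:
  assumes "L2 lborel \<psi>" "L2 lborel f" "L2 lborel g" "snd p > 0"
  shows "L2_inner lborel (\<lambda>z. f z + c * g z) (psi_us \<psi> p)
    = L2_inner lborel f (psi_us \<psi> p) + c * L2_inner lborel g (psi_us \<psi> p)"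
proof -
  have "L2 lborel (psi_us \<psi> p)"
    using L2_psi_us[OF assms(1,4), of "fst p"] by simp
  then show ?thesis by (rule L2_inner_add_scale[OF assms(2,3)])
qed

lemma wavelet_measurable_param:
  assumes "L2 lborel \<psi>" "L2 lborel f"
  shows "(\<lambda>p. L2_inner lborel f (psi_us \<psi> p)) \<in> borel_measurable param_measure"
  using borel_measurable_wavelet[of f \<psi>] assms
  by (simp add: L2_def measurable_cong_sets[OF sets_param_measure refl])

lemma reproducing_iff_sqnorm:
  assumes \<psi>: "L2 lborel \<psi>"
  shows "reproducing param_measure (psi_us \<psi>) \<longleftrightarrow>
    (\<forall>f. L2 lborel f \<longrightarrow> sqnorm param_measure (\<lambda>p. L2_inner lborel f (psi_us \<psi> p)) = sqnorm lborel f)"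
proof (rule trans[OF reproducing_iff_preserves_inner[OF wavelet_measurable_param[OF \<psi>]]],
    assumption, rule preserves_inner_iff_sqnorm)
  fix f g :: "real \<times> real \<Rightarrow> complex" and c
  assume fg: "L2 lborel f" "L2 lborel g"
  show "(\<lambda>p. L2_inner lborel f (psi_us \<psi> p)) \<in> borel_measurable param_measure"
    by (rule wavelet_measurable_param[OF \<psi> fg(1)])
  show "AE p in param_measure. L2_inner lborel (\<lambda>z. f z + c * g z) (psi_us \<psi> p)
      = L2_inner lborel f (psi_us \<psi> p) + c * L2_inner lborel g (psi_us \<psi> p)"
    using AE_param_measure_pos by eventually_elim (rule wavelet_add_scale[OF \<psi> fg])
qed

section \<open>Extension of the isometry from strip functions to L2\<close>

lemma sqnorm_mono:
  assumes "\<And>x. cmod (f x) \<le> cmod (g x)"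
  shows "sqnorm M f \<le> sqnorm M g"
  unfolding sqnorm_def by (intro nn_integral_mono ennreal_leI power_mono assms norm_ge_zero)

text \<open>The parallelogram law for \<open>G\<close> and \<open>G - F\<close>, whose difference
  and sum are \<open>F\<close> and \<open>2 * G - F\<close>, with the term in \<open>G - F\<close>
  dropped.\<close>

lemma sqnorm_parallelogram_le:
  assumes [measurable]: "F \<in> borel_measurable M" "G \<in> borel_measurable M"
  shows "2 * sqnorm M G \<le> sqnorm M F + sqnorm M (\<lambda>x. 2 * G x - F x)"
proof -
  have "2 * (cmod b)\<^sup>2 \<le> (cmod a)\<^sup>2 + (cmod (2 * b - a))\<^sup>2" for a b
  proof -
    have "(cmod a)\<^sup>2 + (cmod (2 * b - a))\<^sup>2 = 2 * (cmod b)\<^sup>2 + 2 * (cmod (b - a))\<^sup>2"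
      unfolding cmod_power2 by (simp add: power2_eq_square algebra_simps)
    then show ?thesis by simp
  qed
  then have "(\<integral>\<^sup>+x. ennreal (2 * (cmod (G x))\<^sup>2) \<partial>M)
      \<le> (\<integral>\<^sup>+x. ennreal ((cmod (F x))\<^sup>2 + (cmod (2 * G x - F x))\<^sup>2) \<partial>M)"
    by (intro nn_integral_mono ennreal_leI)
  then show ?thesis
    unfolding sqnorm_def by (simp add: ennreal_mult ennreal_plus nn_integral_cmult nn_integral_add)
qed

text \<open>At almost every parameter the coefficients of the truncations converge to those of the
  function, so Fatou yields a contraction on all of L2. That contraction is then applied to the
  reflected function to obtain the reverse inequality.\<close>

lemma sqnorm_wavelet_extend:
  assumes \<psi>: "L2 lborel \<psi>"
    and iso: "\<And>f. strip_L2 f \<Longrightarrow>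
      sqnorm param_measure (\<lambda>p. L2_inner lborel f (psi_us \<psi> p)) = sqnorm lborel f"
    and f: "L2 lborel f"
  shows "sqnorm param_measure (\<lambda>p. L2_inner lborel f (psi_us \<psi> p)) = sqnorm lborel f"
proof (rule antisym)
  define W where "W g p = L2_inner lborel g (psi_us \<psi> p)" for g p
  have Wm: "W g \<in> borel_measurable param_measure" if "L2 lborel g" for g
    unfolding W_def[abs_def] by (rule wavelet_measurable_param[OF \<psi> that])
  have contraction: "sqnorm param_measure (W g) \<le> sqnorm lborel g" if g: "L2 lborel g" for g
  proof -
    have "AE p in param_measure. (\<lambda>n. W (strip_trunc n g) p) \<longlonglongrightarrow> W g p"
      using AE_param_measure_pos
    proof eventually_elim
      case (elim p)
      show ?case
        unfolding W_def using L2_psi_us[OF \<psi> elim, of "fst p"]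
        by (intro L2_inner_trunc_tendsto[OF g]) simp
    qed
    then have "sqnorm param_measure (W g) \<le> liminf (\<lambda>n. sqnorm param_measure (W (strip_trunc n g)))"
      by (intro sqnorm_le_liminf Wm g strip_L2_L2[OF strip_L2_trunc[OF g]])
    also have "\<dots> \<le> liminf (\<lambda>n. sqnorm lborel g)"
    proof (intro Liminf_mono always_eventually allI)
      fix n
      have "sqnorm param_measure (W (strip_trunc n g)) = sqnorm lborel (strip_trunc n g)"
        unfolding W_def[abs_def] by (rule iso[OF strip_L2_trunc[OF g]])
      also have "\<dots> \<le> sqnorm lborel g"
        by (rule sqnorm_mono[OF strip_trunc_bound])
      finally show "sqnorm param_measure (W (strip_trunc n g)) \<le> sqnorm lborel g" .
    qed
    finally show ?thesis by (simp add: Liminf_const)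
  qed
  show le: "sqnorm param_measure (\<lambda>p. L2_inner lborel f (psi_us \<psi> p)) \<le> sqnorm lborel f"
    using contraction[OF f] unfolding W_def[abs_def] .
  text \<open>Truncation reflects isometrically: \<open>2 * strip_trunc n f - f\<close> has the same modulus as
    \<open>f\<close>, so the parallelogram law turns the upper bound into a lower bound.\<close>
  have "2 * sqnorm lborel (strip_trunc n f) \<le> sqnorm param_measure (W f) + sqnorm lborel f" for n
  proof -
    let ?t = "strip_trunc n f" and ?r = "\<lambda>z. (- 1) * f z + 2 * strip_trunc n f z"
    have t: "L2 lborel ?t" by (rule strip_L2_L2[OF strip_L2_trunc[OF f]])
    have f': "L2 lborel (\<lambda>z. (- 1) * f z)" by (rule L2_scale[OF f])
    have r: "L2 lborel ?r" by (rule L2_add[OF f' L2_scale[OF t]])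
    have "2 * sqnorm lborel ?t = 2 * sqnorm param_measure (W ?t)"
      unfolding W_def[abs_def] by (subst iso[OF strip_L2_trunc[OF f]]) (rule refl)
    also have "\<dots> \<le> sqnorm param_measure (W f) + sqnorm param_measure (\<lambda>p. 2 * W ?t p - W f p)"
      by (rule sqnorm_parallelogram_le[OF Wm[OF f] Wm[OF t]])
    also have "sqnorm param_measure (\<lambda>p. 2 * W ?t p - W f p) = sqnorm param_measure (W ?r)"
    proof (rule sqnorm_cong_AE)
      show "AE p in param_measure. 2 * W ?t p - W f p = W ?r p"
        using AE_param_measure_pos
      proof eventually_elim
        case (elim p)
        have "W (\<lambda>z. (- 1) * f z) p = (- 1) * W f p"
          unfolding W_def L2_inner_def mult.assoc by (rule Bochner_Integration.integral_mult_right_zero)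
        moreover have "W ?r p = W (\<lambda>z. (- 1) * f z) p + 2 * W ?t p"
          unfolding W_def by (rule wavelet_add_scale[OF \<psi> f' t elim])
        ultimately show ?case by simp
      qed
    qed
    also have "\<dots> \<le> sqnorm lborel ?r" by (rule contraction[OF r])
    also have "\<dots> \<le> sqnorm lborel f"
    proof (rule sqnorm_mono)
      show "cmod (?r z) \<le> cmod (f z)" for z
        by (cases z) (auto simp: strip_trunc_def indicator_def)
    qed
    finally show ?thesis by (simp add: add_left_mono)
  qed
  moreover obtain a where a: "sqnorm lborel f = ennreal a" "a \<ge> 0"
    using sqnorm_eq_integral[OF f] by simp
  moreover obtain b where b: "sqnorm param_measure (W f) = ennreal b" "b \<ge> 0"
    using contraction[OF f] a by (cases "sqnorm param_measure (W f)") (auto simp: top_unique)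
  ultimately have bound: "sqnorm lborel (strip_trunc n f) \<le> ennreal ((b + a) / 2)" for n
  proof -
    obtain c where c: "sqnorm lborel (strip_trunc n f) = ennreal c" "c \<ge> 0"
      using sqnorm_eq_integral[OF strip_L2_L2[OF strip_L2_trunc[OF f]], of n] by simp
    have "ennreal (2 * c) \<le> ennreal (b + a)"
      using \<open>\<And>n. 2 * sqnorm lborel (strip_trunc n f) \<le> _\<close>[of n] a b c
      by (simp add: ennreal_mult ennreal_plus)
    then have "2 * c \<le> b + a"
      using a(2) b(2) by (simp only: ennreal_le_iff add_nonneg_nonneg)
    then show ?thesis using c by (simp add: ennreal_leI)
  qed
  have "sqnorm lborel f \<le> liminf (\<lambda>n. sqnorm lborel (strip_trunc n f))"
    using f strip_L2_L2[OF strip_L2_trunc[OF f]]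
    by (intro sqnorm_le_liminf AE_I2 strip_trunc_tendsto) (simp_all add: L2_def)
  also have "\<dots> \<le> liminf (\<lambda>n. ennreal ((b + a) / 2))"
    by (intro Liminf_mono always_eventually allI bound)
  \<comment> \<open>Here \<open>a\<close> and \<open>b\<close> are the finite values of the two
    norms to be compared; \<open>a \<le> (b + a) / 2\<close> gives \<open>a \<le> b\<close>.\<close>
  finally have "ennreal a \<le> ennreal ((b + a) / 2)"
    by (simp add: Liminf_const a)
  then show "sqnorm lborel f \<le> sqnorm param_measure (\<lambda>p. L2_inner lborel f (psi_us \<psi> p))"
    using a b unfolding W_def[abs_def] by (simp add: ennreal_le_iff)
qed

text \<open>Linearity at \<open>s\<close> holds when the slice of \<open>\<Psi>\<close> at
  \<open>\<sigma> * s\<close> is in L2. The exceptional frequencies form a null set, and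
  \<open>\<sigma> \<noteq> 0\<close> makes its preimage under multiplication by
  \<open>\<sigma>\<close> null as well.\<close>

lemma slice_transform_preserves_inner_iff:
  assumes \<Psi>: "L2 lborel \<Psi>" and "\<sigma> \<noteq> 0"
  shows "preserves_inner lborel half_line_ds_s (slice_transform \<Psi> \<sigma>) \<longleftrightarrow>
    (\<forall>f. L2 lborel f \<longrightarrow> sqnorm half_line_ds_s (slice_transform \<Psi> \<sigma> f) = sqnorm lborel f)"
proof (rule preserves_inner_iff_sqnorm)
  have \<Psi>m: "\<Psi> \<in> borel_measurable borel" using \<Psi> by (simp add: L2_def)
  fix f g :: "real \<Rightarrow> complex" and c
  assume f: "L2 lborel f" and g: "L2 lborel g"
  show "slice_transform \<Psi> \<sigma> f \<in> borel_measurable half_line_ds_s"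
    using slice_transform_measurable[OF \<Psi>m, of f \<sigma>] f by (simp add: L2_def half_line_ds_s_def)
  let ?P = "\<lambda>\<tau>. sqnorm lborel (\<lambda>y. \<Psi> (\<tau>, y)) \<noteq> \<infinity>"
  note [measurable] = borel_pairI[OF \<Psi>m]
  have "Measurable.pred borel ?P"
    unfolding sqnorm_def by measurable
  moreover have "AE \<tau> in lborel. ?P \<tau>"
    using L2_slices(1)[OF \<Psi>] by eventually_elim (simp add: L2_iff_sqnorm less_top)
  ultimately have "AE s in lborel. ?P (0 + \<sigma> * s)"
    by (rule AE_borel_affine[OF assms(2)])
  then have "AE s in lborel. slice_transform \<Psi> \<sigma> (\<lambda>x. f x + c * g x) s
      = slice_transform \<Psi> \<sigma> f s + c * slice_transform \<Psi> \<sigma> g s"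
  proof eventually_elim
    case (elim s)
    then have L: "L2 lborel (\<lambda>y. \<Psi> (\<sigma> * s, y))"
      using L2_slice_measurable(1)[OF \<Psi>m] by (simp add: L2_iff_sqnorm less_top)
    have "slice_transform \<Psi> \<sigma> k s = L2_inner lborel k (\<lambda>y. \<Psi> (\<sigma> * s, y))" for k
      unfolding slice_transform_def L2_inner_def by (simp only: mult.commute)
    then show ?case using L2_inner_add_scale[OF f g L, of c] by simp
  qed
  then show "AE s in half_line_ds_s. slice_transform \<Psi> \<sigma> (\<lambda>x. f x + c * g x) s
      = slice_transform \<Psi> \<sigma> f s + c * slice_transform \<Psi> \<sigma> g s"
    unfolding half_line_ds_s_def by (subst AE_density) auto
qed

section \<open>Separation of positive and negative frequencies\<close>

text \<open>For large positive or negative \<open>a\<close> the average sees almost only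
  \<open>X\<close> or only \<open>Y\<close>. Since these may be infinite at the outset, Fatou first
  bounds both by \<open>c\<close>; \<open>w\<close> times \<open>c\<close> then dominates, and the
  limit becomes an equality.\<close>

lemma constants_eq_of_shifted_average:
  fixes X Y c :: ennreal and w :: "real \<Rightarrow> ennreal"
  assumes [measurable]: "w \<in> borel_measurable borel"
    and w: "(\<integral>\<^sup>+\<eta>. w \<eta> \<partial>lborel) = 1"
    and c: "c < \<infinity>"
    and avg: "\<And>a. (\<integral>\<^sup>+\<eta>. w \<eta> * (if \<eta> + a > 0 then X else Y) \<partial>lborel) = c"
  shows "X = c" "Y = c"
proof -
  let ?g = "\<lambda>a \<eta>. w \<eta> * (if \<eta> + a > 0 then X else Y)"
  have const: "(\<integral>\<^sup>+\<eta>. w \<eta> * Z \<partial>lborel) = Z" for Z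
    by (simp add: nn_integral_multc w)
  have limX: "(\<lambda>n. ?g (real n) \<eta>) \<longlonglongrightarrow> w \<eta> * X" for \<eta>
  proof (rule tendsto_eventually)
    obtain N where "- \<eta> < real N" using reals_Archimedean2 by blast
    then show "eventually (\<lambda>n. ?g (real n) \<eta> = w \<eta> * X) sequentially"
      by (intro eventually_sequentiallyI[of N]) auto
  qed
  have limY: "(\<lambda>n. ?g (- real n) \<eta>) \<longlonglongrightarrow> w \<eta> * Y" for \<eta>
  proof (rule tendsto_eventually)
    obtain N where "\<eta> < real N" using reals_Archimedean2 by blast
    then show "eventually (\<lambda>n. ?g (- real n) \<eta> = w \<eta> * Y) sequentially"
      by (intro eventually_sequentiallyI[of N]) auto
  qed
  have fatou: "Z \<le> c" if lim: "\<And>\<eta>. (\<lambda>n. ?g (a n) \<eta>) \<longlonglongrightarrow> w \<eta> * Z" for a :: "nat \<Rightarrow> real" and Z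
  proof -
    have "Z = (\<integral>\<^sup>+\<eta>. liminf (\<lambda>n. ?g (a n) \<eta>) \<partial>lborel)"
      unfolding lim_imp_Liminf[OF sequentially_bot lim] const ..
    also have "\<dots> \<le> liminf (\<lambda>n. \<integral>\<^sup>+\<eta>. ?g (a n) \<eta> \<partial>lborel)"
      by (rule nn_integral_liminf) measurable
    finally show ?thesis by (simp add: avg Liminf_const)
  qed
  have X: "X \<le> c" by (rule fatou[OF limX])
  have Y: "Y \<le> c" by (rule fatou[OF limY])
  have dct: "Z = c" if lim: "\<And>\<eta>. (\<lambda>n. ?g (a n) \<eta>) \<longlonglongrightarrow> w \<eta> * Z" for a :: "nat \<Rightarrow> real" and Z
  proof -
    have "(\<lambda>n. \<integral>\<^sup>+\<eta>. ?g (a n) \<eta> \<partial>lborel) \<longlonglongrightarrow> (\<integral>\<^sup>+\<eta>. w \<eta> * Z \<partial>lborel)"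
    proof (rule nn_integral_dominated_convergence[where w="\<lambda>\<eta>. w \<eta> * c"])
      show "(\<integral>\<^sup>+\<eta>. w \<eta> * c \<partial>lborel) < \<infinity>" using c by (simp add: const)
      show "AE \<eta> in lborel. ?g (a n) \<eta> \<le> w \<eta> * c" for n
        using X Y by (intro AE_I2 mult_left_mono) auto
      show "AE \<eta> in lborel. (\<lambda>n. ?g (a n) \<eta>) \<longlonglongrightarrow> w \<eta> * Z"
        by (intro AE_I2 lim)
    qed measurable
    then have "(\<lambda>n. c) \<longlonglongrightarrow> Z" unfolding avg const .
    then show ?thesis by (simp add: LIMSEQ_const_iff)
  qed
  show "X = c" by (rule dct[OF limX])
  show "Y = c" by (rule dct[OF limY])
qed

text \<open>Modulation translates the frequency profile, so \<open>a \<rightarrow> \<plusminus>\<infinity>\<close> concentrates it on one half line.\<close>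
definition modulated_box :: "real \<Rightarrow> (real \<Rightarrow> complex) \<Rightarrow> real \<times> real \<Rightarrow> complex" where
  "modulated_box a h = (\<lambda>(x, y). indicator {0..1} x * cis (2 * pi * a * x) * h y)"

definition box_hat :: "real \<Rightarrow> complex" where
  "box_hat = fourier (indicator {0..1})"

lemma box_integrable: "integrable lborel (indicator {0..1} :: real \<Rightarrow> complex)"
  by (rule integrable_complex_indicator) (simp_all add: emeasure_lborel_Icc_eq)

lemma sqnorm_indicator_unit: "sqnorm lborel (indicator {0..1} :: real \<Rightarrow> complex) = 1"
proof -
  have "ennreal ((cmod (indicator {0..1} x))\<^sup>2) = indicator {0..1} x" for x :: real
    by (simp add: indicator_def)
  then show ?thesis by (simp add: sqnorm_def emeasure_lborel_Icc_eq)
qed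

lemma box_hat_measurable [measurable]: "box_hat \<in> borel_measurable borel"
  unfolding box_hat_def by measurable

text \<open>Plancherel makes the squared modulus of \<open>box_hat\<close> a probability density,
  the weight of the averages below, without an explicit formula for it.\<close>

lemma sqnorm_box_hat: "sqnorm lborel box_hat = 1"
  unfolding box_hat_def sqnorm_fourier[OF box_integrable] by (rule sqnorm_indicator_unit)

lemma sqnorm_modulated_box:
  assumes [measurable]: "h \<in> borel_measurable borel"
  shows "sqnorm lborel (modulated_box a h) = sqnorm lborel h"
    and "modulated_box a h \<in> borel_measurable borel"
proof -
  have "modulated_box a h \<in> borel_measurable (borel \<Otimes>\<^sub>M borel)"
    unfolding modulated_box_def by measurable
  then show m: "modulated_box a h \<in> borel_measurable borel"
    by (rule borel_measurable_pair_iff[THEN iffD1])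
  have "sqnorm lborel (\<lambda>x. modulated_box a h (x, y)) = ennreal ((cmod (h y))\<^sup>2)" for y
  proof -
    have "sqnorm lborel (\<lambda>x. modulated_box a h (x, y)) = sqnorm lborel (\<lambda>x :: real. h y * indicator {0..1} x)"
      unfolding sqnorm_def modulated_box_def by (simp add: norm_mult mult.commute)
    also have "\<dots> = ennreal ((cmod (h y))\<^sup>2) * sqnorm lborel (indicator {0..1} :: real \<Rightarrow> complex)"
      by (rule sqnorm_scale) measurable
    finally show ?thesis by (simp add: sqnorm_indicator_unit)
  qed
  then show "sqnorm lborel (modulated_box a h) = sqnorm lborel h"
    unfolding sqnorm_prod(2)[OF m] by (simp add: sqnorm_def)
qed

lemma strip_L2_modulated_box:
  assumes "L2 lborel h"
  shows "strip_L2 (modulated_box a h)"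
proof -
  have "L2 lborel (modulated_box a h)"
    using assms sqnorm_modulated_box[of h a] by (simp add: L2_iff_sqnorm)
  moreover have "\<forall>x y. 1 < \<bar>x\<bar> \<longrightarrow> modulated_box a h (x, y) = 0"
    by (auto simp: modulated_box_def indicator_def)
  ultimately show ?thesis unfolding strip_L2_def by blast
qed

lemma partial_fourier_modulated_box:
  "partial_fourier (modulated_box a h) (\<xi>, y) = box_hat (\<xi> - a) * h y"
proof -
  have "indicator {0..1} x * cis (2 * pi * a * x) * h y * cis (- 2 * pi * x * \<xi>)
      = indicator {0..1} x * cis (- 2 * pi * x * (\<xi> - a)) * h y" for x
  proof -
    have "cis (2 * pi * a * x) * cis (- 2 * pi * x * \<xi>) = cis (- 2 * pi * x * (\<xi> - a))"
      unfolding cis_mult by (simp add: algebra_simps)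
    then show ?thesis by (metis mult.assoc mult.commute)
  qed
  then show ?thesis
    unfolding partial_fourier_def fourier_def box_hat_def modulated_box_def prod.case
    by (simp only: Bochner_Integration.integral_mult_left_zero)
qed

lemma slice_transform_scale:
  "slice_transform \<Psi> \<sigma> (\<lambda>y. c * h y) = (\<lambda>s. c * slice_transform \<Psi> \<sigma> h s)"
  unfolding slice_transform_def
  by (simp only: mult.left_commute[of "cnj _" c] Bochner_Integration.integral_mult_right_zero)

text \<open>For a modulated box times \<open>h\<close>, the norm of the wavelet coefficients is an
  average of the two slice norms of \<open>h\<close>, weighted by the translated squared modulus of
  \<open>box_hat\<close>. The average equals the norm of \<open>h\<close> for every modulation
  \<open>a\<close>, which forces both slice norms to that value.\<close>

lemma slice_transform_isometric_of_wavelet: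
  assumes \<psi>: "L2 lborel \<psi>" and \<Psi>: "is_partial_FT \<psi> \<Psi>"
    and iso: "\<And>f. L2 lborel f \<Longrightarrow>
      sqnorm param_measure (\<lambda>p. L2_inner lborel f (psi_us \<psi> p)) = sqnorm lborel f"
    and h: "L2 lborel h" and \<sigma>: "\<sigma> \<in> {1, -1}"
  shows "sqnorm half_line_ds_s (slice_transform \<Psi> \<sigma> h) = sqnorm lborel h"
proof -
  have \<Psi>m: "\<Psi> \<in> borel_measurable borel"
    using \<Psi> by (simp add: is_partial_FT_def L2_def)
  have hm: "h \<in> borel_measurable borel" using h by (simp add: L2_def)
  define X where "X \<sigma> = sqnorm half_line_ds_s (slice_transform \<Psi> \<sigma> h)" for \<sigma>
  let ?w = "\<lambda>\<eta>. ennreal ((cmod (box_hat \<eta>))\<^sup>2)"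
  have avg: "(\<integral>\<^sup>+\<eta>. ?w \<eta> * (if \<eta> + a > 0 then X 1 else X (- 1)) \<partial>lborel) = sqnorm lborel h" for a
  proof -
    have m: "(\<lambda>\<xi>. ?w (\<xi> - a) * X (half_sign \<xi>)) \<in> borel_measurable borel"
      unfolding half_sign_def if_distrib[of X] by measurable
    have box: "strip_L2 (modulated_box a h)" by (rule strip_L2_modulated_box[OF h])
    have "sqnorm lborel h = sqnorm param_measure (\<lambda>p. L2_inner lborel (modulated_box a h) (psi_us \<psi> p))"
      unfolding iso[OF strip_L2_L2[OF box]] sqnorm_modulated_box(1)[OF hm] ..
    also have "\<dots> = (\<integral>\<^sup>+\<xi>. sqnorm half_line_ds_s
        (slice_transform \<Psi> (half_sign \<xi>) (\<lambda>y. partial_fourier (modulated_box a h) (\<xi>, y))) \<partial>lborel)"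
      by (rule sqnorm_wavelet[OF box \<psi> \<Psi>])
    also have "\<dots> = (\<integral>\<^sup>+\<xi>. ?w (\<xi> - a) * X (half_sign \<xi>) \<partial>lborel)"
    proof (rule nn_integral_cong)
      fix \<xi>
      have "slice_transform \<Psi> (half_sign \<xi>) h \<in> borel_measurable half_line_ds_s"
        using slice_transform_measurable[OF \<Psi>m hm] by (simp add: half_line_ds_s_def)
      then show "sqnorm half_line_ds_s
          (slice_transform \<Psi> (half_sign \<xi>) (\<lambda>y. partial_fourier (modulated_box a h) (\<xi>, y)))
          = ?w (\<xi> - a) * X (half_sign \<xi>)"
        unfolding partial_fourier_modulated_box slice_transform_scale X_def by (rule sqnorm_scale)
    qed
    also have "\<dots> = (\<integral>\<^sup>+\<eta>. ?w \<eta> * X (half_sign (\<eta> + a)) \<partial>lborel)"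
      using nn_integral_real_affine[OF m, of 1 a] by (simp add: add.commute)
    finally show ?thesis unfolding half_sign_def if_distrib[of X] by (rule sym)
  qed
  have w: "(\<integral>\<^sup>+\<eta>. ?w \<eta> \<partial>lborel) = 1"
    using sqnorm_box_hat by (simp add: sqnorm_def)
  have wm: "?w \<in> borel_measurable borel" by measurable
  have "sqnorm lborel h < \<infinity>" using h by (simp add: L2_iff_sqnorm)
  from constants_eq_of_shifted_average[OF wm w this avg] show ?thesis
    using \<sigma> unfolding X_def by blast
qed

text \<open>Almost every frequency slice of the partial transform is in L2, so one of the two
  isometries applies to it. Integrating over the frequency settles strip functions, and
  \<open>sqnorm_wavelet_extend\<close> does the rest.\<close>

lemma wavelet_isometric_of_slice_transform:
  assumes \<psi>: "L2 lborel \<psi>" and \<Psi>: "is_partial_FT \<psi> \<Psi>"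
    and iso: "\<And>\<sigma> h. \<sigma> \<in> {1, -1} \<Longrightarrow> L2 lborel h \<Longrightarrow>
      sqnorm half_line_ds_s (slice_transform \<Psi> \<sigma> h) = sqnorm lborel h"
    and f: "L2 lborel f"
  shows "sqnorm param_measure (\<lambda>p. L2_inner lborel f (psi_us \<psi> p)) = sqnorm lborel f"
proof (rule sqnorm_wavelet_extend[OF \<psi> _ f])
  fix g assume g: "strip_L2 g"
  let ?G = "partial_fourier g"
  have G: "L2 lborel ?G" by (rule L2_partial_fourier[OF g])
  have "sqnorm param_measure (\<lambda>p. L2_inner lborel g (psi_us \<psi> p)) = (\<integral>\<^sup>+\<xi>. sqnorm half_line_ds_s
      (slice_transform \<Psi> (half_sign \<xi>) (\<lambda>y. ?G (\<xi>, y))) \<partial>lborel)"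
    by (rule sqnorm_wavelet[OF g \<psi> \<Psi>])
  also have "\<dots> = (\<integral>\<^sup>+\<xi>. sqnorm lborel (\<lambda>y. ?G (\<xi>, y)) \<partial>lborel)"
    by (rule nn_integral_cong_AE) (use L2_slices(1)[OF G] in eventually_elim, rule iso[OF half_sign_mem])
  also have "\<dots> = sqnorm lborel ?G"
    using G by (intro sqnorm_prod(1)[symmetric]) (simp add: L2_def)
  also have "\<dots> = sqnorm lborel g" by (rule sqnorm_partial_fourier[OF g])
  finally show "sqnorm param_measure (\<lambda>p. L2_inner lborel g (psi_us \<psi> p)) = sqnorm lborel g" .
qed

theorem theorem1p1:
  fixes \<psi> \<Psi> :: "real \<times> real \<Rightarrow> complex"
  assumes "L2 lborel \<psi>"
    and "is_partial_FT \<psi> \<Psi>"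
  shows "reproducing param_measure (psi_us \<psi>) \<longleftrightarrow>
    (\<forall>\<sigma>\<in>{1, -1::real}.
       preserves_inner (lborel :: real measure) half_line_ds_s
         (\<lambda>f s. LINT y|lborel. cnj (\<Psi> (\<sigma> * s, y)) * f y))"
proof -
  have \<Psi>2: "L2 lborel \<Psi>" using assms(2) unfolding is_partial_FT_def by blast
  have iff: "preserves_inner lborel half_line_ds_s (\<lambda>f s. LINT y|lborel. cnj (\<Psi> (\<sigma> * s, y)) * f y) \<longleftrightarrow>
      (\<forall>h. L2 lborel h \<longrightarrow> sqnorm half_line_ds_s (slice_transform \<Psi> \<sigma> h) = sqnorm lborel h)"
    if "\<sigma> \<in> {1, -1}" for \<sigma>
    using that slice_transform_preserves_inner_iff[OF \<Psi>2, of \<sigma>]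
    unfolding slice_transform_def by auto
  show ?thesis
    unfolding reproducing_iff_sqnorm[OF assms(1)]
    using iff slice_transform_isometric_of_wavelet[OF assms] wavelet_isometric_of_slice_transform[OF assms]
    by blast
qed

end
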